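(* Let $K$ be a primitive triangulation of a smooth $(n+1)$-dimensional lattice polytope $P$. Then $K$ is $\rho$-uniform if and only if, for all interior $n$-simplices $\sigma^n$ of $K$, the function $$\rho_{\sigma^n}:\{\text{vertices of }\sigma^n\}\to\mathbb F_2$$ is constant on the subset of vertices of $\sigma^n$ contained in the interior of $K$ (the condition being vacuously true when every vertex of $\sigma^n$ is contained in the boundary of $K$).
   Context: Polytope and triangulation. $M,N$ are dual lattices of rank $n+1$, $n\ge1$, with pairing $\langle-,-\rangle$; $M_2=M\otimes\mathbb F_2$, $N_2=N\otimes\mathbb F_2$. A full-dimensional lattice polytope $P\subset M\otimes\mathbb R$ is smooth if it is simple and at each vertex the primitive edge directions form a basis of $M$. A primitive triangulation $K$ of $P$ is a triangulation into lattice simplices whose maximal simplices have volume $1/(n+1)!$ (unit volume = parallelepiped on a basis of $M$); its vertices are exactly $P\cap M$. A simplex (or vertex) is interior if it is not contained in $\partial P$. The functions $\rho_{\sigma^n}$. For an interior $n$-simplex $\sigma^n$ let $v_1,v_2$ be the apices of its two adjacent $(n+1)$-simplices. There are unique $\rho_{\sigma^n}(v)\in\mathbb F_2$, $v$ a vertex of $\sigma^n$, with $\sum_{v\in\sigma^n}\rho_{\sigma^n}(v)=0$ and $\sum_{v\in\sigma^n}\rho_{\sigma^n}(v)v=v_1-v_2$ in $M_2$. Complexes. For $\sigma\le\tau$ in $K$, $[\sigma,\tau]$ is the union of the simplices of the barycentric subdivision given by flags between $\sigma$ and $\tau$; for $\sigma$ contained in a face $Q$ of $P$, $[\sigma,Q]=\bigcup_{\sigma\le\tau\subset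 Q}[\sigma,\tau]$ is a ball of dimension $\dim Q-\dim\sigma$. These are the closed cells of a regular CW structure $Y$ on $P$, with $[\sigma',Q']\le[\sigma,Q]$ iff $\sigma'\ge\sigma$, $Q'\subset Q$. $X\le Y$ is the subcomplex of cells with $\dim\sigma\ge1$. Put $\sigma^*=[\sigma,P]$ and $X_0=X\cap\bigcup_{v\text{ interior vertex}}v^*$. Waves and Hessian. A cellular sheaf $\mathcal G$ of $\mathbb F_2$-vector spaces has functorial maps $\mathcal G(e')\to\mathcal G(e)$ for $e'\le e$; $H^q(-;\mathcal G)$ is its cellular cohomology. $\mathcal W_1$ is the sheaf on $X$ with $\mathcal W_1(\sigma,Q)=((T\sigma)^\perp\cap N)\otimes\mathbb F_2\subset N_2$ ($T\sigma$ the linear tangent space) and inclusions as transition maps. $\mathcal Z^1$ is the sheaf $[\sigma,Q]\mapsto Z^1(\sigma;\mathbb F_2)$ (simplicial 1-cocycles, restrictions). There is a short exact sequence $0\to\mathcal W_1\to N_2\xrightarrow{z}\mathcal Z^1|_X\to0$ with $N_2$ constant and $z(u)(\sigma^1)=\langle v_0-v_1,u\rangle$ for an edge $\sigma^1$ with endpoints $v_0,v_1$. For $\varepsilon\in C^0(K;\mathbb F_2)$, $\nabla^2\varepsilon\in H^1(X;\mathcal W_1)$ is the image under the connecting morphism $H^0(X;\mathcal Z^1)\to H^1(X;\mathcal W_1)$ of the section $[\sigma,Q]\mapsto\mathrm d\varepsilon|_\sigma$. $K$ is $\rho$-uniform if there is a (necessarily unique) $\rho\in H^1(X_0;\mathcal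 W_1)$ with $\rho|_{\partial v^*}=\nabla^2\chi_v|_{\partial v^*}$ for every interior vertex $v$ of $K$, where $\chi_v\in C^0(K;\mathbb F_2)$ is $1$ on $v$ and $0$ elsewhere. *)

theory Defs
  imports "HOL-Analysis.Analysis" "HOL-Library.Z2" "HOL-Library.Function_Algebras"
begin

section \<open>Lattices, smooth polytopes and primitive triangulations\<close>

text \<open>
  A basis of \<open>M\<close> is fixed once and for all, so that \<open>M\<close> is the lattice of integer points of
  \<open>real ^ 'm\<close> and its rank is \<open>CARD('m)\<close>; the pairing is the inner product.  The field with two
  elements is the type \<open>bit\<close>, and both \<open>M\<^sub>2\<close> and \<open>N\<^sub>2\<close> are \<open>bit ^ 'm\<close>.
\<close>

definition lat_M :: "(real ^ 'm) set"
  where "lat_M = {x. \<forall>i. x $ i \<in> \<int>}"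

definition lat_N :: "(real ^ 'm) set"
  where "lat_N = {u. \<forall>x\<in>lat_M. x \<bullet> u \<in> \<int>}"

text \<open>Reduction modulo 2 of integer points; the floor is only there to make the function total.\<close>
definition red2 :: "real ^ 'm \<Rightarrow> bit ^ 'm"
  where "red2 x = (\<chi> i. of_int \<lfloor>x $ i\<rfloor>)"

definition pairing2 :: "bit ^ 'm \<Rightarrow> bit ^ 'm \<Rightarrow> bit"
  where "pairing2 a u = (\<Sum>i\<in>UNIV. a $ i * u $ i)"

definition lattice_basis :: "(real ^ 'm) set \<Rightarrow> bool"
  where "lattice_basis D \<longleftrightarrow> finite D \<and> independent D
    \<and> lat_M = range (\<lambda>c :: real ^ 'm \<Rightarrow> int. \<Sum>d\<in>D. of_int (c d) *\<^sub>R d)"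

definition primitive_vector :: "real ^ 'm \<Rightarrow> bool"
  where "primitive_vector d \<longleftrightarrow> d \<in> lat_M \<and> d \<noteq> 0
    \<and> (\<forall>x\<in>lat_M. \<forall>k::int. d = of_int k *\<^sub>R x \<longrightarrow> \<bar>k\<bar> = 1)"

definition vertices :: "(real ^ 'm) set \<Rightarrow> (real ^ 'm) set"
  where "vertices S = {v. v extreme_point_of S}"

definition primitive_edge_directions :: "(real ^ 'm) set \<Rightarrow> real ^ 'm \<Rightarrow> (real ^ 'm) set"
  where "primitive_edge_directions P v =
    {d. primitive_vector d \<and> (\<exists>e t. e edge_of P \<and> v \<in> e \<and> t > 0 \<and> v + t *\<^sub>R d \<in> e)}"

definition lattice_polytope :: "(real ^ 'm) set \<Rightarrow> bool"
  where "lattice_polytope P \<longleftrightarrow> (\<exists>V. finite V \<and> V \<subseteq> lat_M \<and> P = convex hull V)"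

definition simple_polytope :: "(real ^ 'm) set \<Rightarrow> bool"
  where "simple_polytope P \<longleftrightarrow> polytope P
    \<and> (\<forall>v\<in>vertices P. int (card {F. F facet_of P \<and> v \<in> F}) = aff_dim P)"

definition smooth_polytope :: "(real ^ 'm) set \<Rightarrow> bool"
  where "smooth_polytope P \<longleftrightarrow> lattice_polytope P \<and> aff_dim P = int CARD('m)
    \<and> simple_polytope P \<and> (\<forall>v\<in>vertices P. lattice_basis (primitive_edge_directions P v))"

text \<open>
  Beware that \<^const>\<open>simplicial_complex\<close> counts the empty set as a simplex of dimension \<open>-1\<close>;
  it is excluded below wherever that matters.
\<close>
definition primitive_triangulation :: "(real ^ 'm) set set \<Rightarrow> (real ^ 'm) set \<Rightarrow> bool"
  where "primitive_triangulation K P \<longleftrightarrow> simplicial_complex K \<and> \<Union>K = P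
    \<and> (\<forall>\<sigma>\<in>K. vertices \<sigma> \<subseteq> lat_M)
    \<and> (\<forall>\<sigma>\<in>K. (\<forall>\<tau>\<in>K. \<sigma> \<subseteq> \<tau> \<longrightarrow> \<tau> = \<sigma>) \<longrightarrow> measure lebesgue \<sigma> = 1 / fact CARD('m))"

definition interior_simplices :: "(real ^ 'm) set set \<Rightarrow> (real ^ 'm) set \<Rightarrow> int \<Rightarrow> (real ^ 'm) set set"
  where "interior_simplices K P d = {\<sigma>\<in>K. aff_dim \<sigma> = d \<and> \<not> \<sigma> \<subseteq> frontier P}"

definition interior_vertices :: "(real ^ 'm) set set \<Rightarrow> (real ^ 'm) set \<Rightarrow> (real ^ 'm) set"
  where "interior_vertices K P = {v. {v} \<in> interior_simplices K P 0}"


section \<open>The functions \<open>\<rho>\<^sub>\<sigma>\<close>\<close>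

definition apices :: "(real ^ 'm) set set \<Rightarrow> (real ^ 'm) set \<Rightarrow> (real ^ 'm) set"
  where "apices K \<sigma> = {v. \<exists>\<tau>\<in>K. \<sigma> facet_of \<tau> \<and> v \<in> vertices \<tau> \<and> v \<notin> \<sigma>}"

text \<open>A function on the vertices of \<open>\<sigma>\<close> is extended by 0, which makes the description unique.\<close>
definition rho_fun :: "(real ^ 'm) set set \<Rightarrow> (real ^ 'm) set \<Rightarrow> real ^ 'm \<Rightarrow> bit"
  where "rho_fun K \<sigma> = (THE r. (\<forall>v. v \<notin> vertices \<sigma> \<longrightarrow> r v = 0)
    \<and> (\<Sum>v\<in>vertices \<sigma>. r v) = 0
    \<and> (\<exists>v1 v2. v1 \<noteq> v2 \<and> apices K \<sigma> = {v1, v2}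
          \<and> (\<Sum>v\<in>vertices \<sigma>. r v *s red2 v) = red2 v1 - red2 v2))"


section \<open>The regular CW complexes \<open>Y\<close>, \<open>X\<close> and \<open>X\<^sub>0\<close>\<close>

text \<open>
  The closed cell \<open>[\<sigma>, Q]\<close>, that is, the union of the simplices of the barycentric subdivision
  of \<open>K\<close> belonging to flags of simplices between \<open>\<sigma>\<close> and simplices of \<open>K\<close> in \<open>Q\<close>, is
  represented by the pair \<open>(\<sigma>, Q)\<close>.  Cellular sheaves and their cohomology only use the face
  poset of the regular CW complex and the dimensions of its cells.  A subcomplex is a set of
  cells closed under passing to faces.
\<close>
type_synonym 'm cell = "(real ^ 'm) set \<times> (real ^ 'm) set"

definition cell_le :: "'m::finite cell \<Rightarrow> 'm cell \<Rightarrow> bool"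
  where "cell_le e' e \<longleftrightarrow> fst e face_of fst e' \<and> snd e' \<subseteq> snd e"

definition cell_dim :: "'m::finite cell \<Rightarrow> int"
  where "cell_dim e = aff_dim (snd e) - aff_dim (fst e)"

definition cpx_Y :: "(real ^ 'm) set set \<Rightarrow> (real ^ 'm) set \<Rightarrow> 'm::finite cell set"
  where "cpx_Y K P = {(\<sigma>, Q). \<sigma> \<in> K \<and> \<sigma> \<noteq> {} \<and> Q face_of P \<and> \<sigma> \<subseteq> Q}"

definition cpx_X :: "(real ^ 'm) set set \<Rightarrow> (real ^ 'm) set \<Rightarrow> 'm::finite cell set"
  where "cpx_X K P = {e \<in> cpx_Y K P. aff_dim (fst e) \<ge> 1}"

text \<open>The subcomplexes \<open>\<sigma>\<^sup>* = [\<sigma>, P]\<close> and \<open>\<partial>\<sigma>\<^sup>*\<close>\<close>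
definition dual_cell :: "(real ^ 'm) set set \<Rightarrow> (real ^ 'm) set \<Rightarrow> (real ^ 'm) set \<Rightarrow> 'm::finite cell set"
  where "dual_cell K P \<sigma> = {e \<in> cpx_Y K P. cell_le e (\<sigma>, P)}"

definition dual_cell_boundary ::
    "(real ^ 'm) set set \<Rightarrow> (real ^ 'm) set \<Rightarrow> (real ^ 'm) set \<Rightarrow> 'm::finite cell set"
  where "dual_cell_boundary K P \<sigma> = dual_cell K P \<sigma> - {(\<sigma>, P)}"

definition cpx_X0 :: "(real ^ 'm) set set \<Rightarrow> (real ^ 'm) set \<Rightarrow> 'm::finite cell set"
  where "cpx_X0 K P = cpx_X K P \<inter> (\<Union>v\<in>interior_vertices K P. dual_cell K P {v})"


section \<open>Cellular sheaves over the field with two elements and their cohomology\<close>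

text \<open>
  \<open>stalk F e\<close> is the value of the sheaf on \<open>e\<close>, a subspace of an ambient type, and
  \<open>trans_map F e' e\<close> is the map \<open>F(e') \<rightarrow> F(e)\<close> for \<open>e' \<le> e\<close>.
\<close>
record ('m, 'v) sheaf =
  stalk :: "'m cell \<Rightarrow> 'v set"
  trans_map :: "'m cell \<Rightarrow> 'm cell \<Rightarrow> 'v \<Rightarrow> 'v"

text \<open>
  Cellular cochains on a subcomplex \<open>A\<close>, extended by 0 to all pairs.  In a regular CW complex the
  incidence number of a cell and a face of codimension 1 is \<open>\<plusminus>1\<close>, so no signs occur over \<open>bit\<close>.
\<close>
definition cochains ::
    "'m::finite cell set \<Rightarrow> ('m, 'v::ab_group_add) sheaf \<Rightarrow> nat \<Rightarrow> ('m cell \<Rightarrow> 'v) set"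
  where "cochains A F q =
    {c. \<forall>e. if e \<in> A \<and> cell_dim e = int q then c e \<in> stalk F e else c e = 0}"

definition cobd ::
    "'m::finite cell set \<Rightarrow> ('m, 'v::ab_group_add) sheaf \<Rightarrow> ('m cell \<Rightarrow> 'v) \<Rightarrow> 'm cell \<Rightarrow> 'v"
  where "cobd A F c = (\<lambda>e. if e \<in> A
    then \<Sum>e' | e' \<in> A \<and> cell_le e' e \<and> cell_dim e = cell_dim e' + 1. trans_map F e' e (c e')
    else 0)"

definition cocycles ::
    "'m::finite cell set \<Rightarrow> ('m, 'v::ab_group_add) sheaf \<Rightarrow> nat \<Rightarrow> ('m cell \<Rightarrow> 'v) set"
  where "cocycles A F q = {c \<in> cochains A F q. cobd A F c = 0}"

definition coboundaries ::
    "'m::finite cell set \<Rightarrow> ('m, 'v::ab_group_add) sheaf \<Rightarrow> nat \<Rightarrow> ('m cell \<Rightarrow> 'v) set"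
  where "coboundaries A F q = (case q of 0 \<Rightarrow> {0} | Suc p \<Rightarrow> cobd A F ` cochains A F p)"

definition cohomologous ::
    "'m::finite cell set \<Rightarrow> ('m, 'v::ab_group_add) sheaf \<Rightarrow> nat \<Rightarrow> ('m cell \<Rightarrow> 'v) rel"
  where "cohomologous A F q =
    {(c, c'). c \<in> cocycles A F q \<and> c' \<in> cocycles A F q \<and> c - c' \<in> coboundaries A F q}"

definition cohomology ::
    "'m::finite cell set \<Rightarrow> ('m, 'v::ab_group_add) sheaf \<Rightarrow> nat \<Rightarrow> ('m cell \<Rightarrow> 'v) set set"
  where "cohomology A F q = cocycles A F q // cohomologous A F q"

text \<open>The restriction \<open>H\<^sup>q(A; F) \<rightarrow> H\<^sup>q(B; F)\<close> to a subcomplex \<open>B\<close> of \<open>A\<close>, on cohomology classes\<close>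
definition restrict_class ::
    "'m::finite cell set \<Rightarrow> ('m, 'v::ab_group_add) sheaf \<Rightarrow> nat
      \<Rightarrow> ('m cell \<Rightarrow> 'v) set \<Rightarrow> ('m cell \<Rightarrow> 'v) set"
  where "restrict_class B F q C =
    cohomologous B F q `` ((\<lambda>c e. if e \<in> B then c e else 0) ` C)"

text \<open>The element of \<open>H\<^sup>0(A; F)\<close> given by a global section\<close>
definition section_class ::
    "'m::finite cell set \<Rightarrow> ('m, 'v::ab_group_add) sheaf \<Rightarrow> ('m cell \<Rightarrow> 'v) \<Rightarrow> ('m cell \<Rightarrow> 'v) set"
  where "section_class A F s =
    cohomologous A F 0 `` {\<lambda>e. if e \<in> A \<and> cell_dim e = 0 then s e else 0}"

text \<open>
  The connecting morphism \<open>H\<^sup>q(A; H) \<rightarrow> H\<^sup>q\<^sup>+\<^sup>1(A; F)\<close> of a short exact sequence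
  \<open>0 \<rightarrow> F \<rightarrow> G \<rightarrow> H \<rightarrow> 0\<close> with maps \<open>i\<close> and \<open>p\<close>: lift a cocycle along \<open>p\<close>, apply the coboundary
  and pull back along \<open>i\<close>.  The sheaf \<open>H\<close> enters only through the class \<open>C\<close>.
\<close>
definition connecting ::
    "'m::finite cell set \<Rightarrow> ('m, 'u::ab_group_add) sheaf \<Rightarrow> ('m, 'v::ab_group_add) sheaf
      \<Rightarrow> ('m cell \<Rightarrow> 'u \<Rightarrow> 'v) \<Rightarrow> ('m cell \<Rightarrow> 'v \<Rightarrow> 'w::ab_group_add) \<Rightarrow> nat
      \<Rightarrow> ('m cell \<Rightarrow> 'w) set \<Rightarrow> ('m cell \<Rightarrow> 'u) set"
  where "connecting A F G i p q C = cohomologous A F (Suc q) ``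
    {c \<in> cochains A F (Suc q). \<exists>g\<in>cochains A G q.
        (\<lambda>e. p e (g e)) \<in> C \<and> (\<lambda>e. i e (c e)) = cobd A G g}"


section \<open>The sheaves \<open>\<W>\<^sub>1\<close>, \<open>N\<^sub>2\<close> and \<open>\<Z>\<^sup>1\<close>\<close>

definition tangent_space :: "(real ^ 'm) set \<Rightarrow> (real ^ 'm) set"
  where "tangent_space \<sigma> = span {x - y | x y. x \<in> \<sigma> \<and> y \<in> \<sigma>}"

text \<open>
  The subgroup \<open>(T\<sigma>)\<^sup>\<bottom> \<inter> N\<close> is saturated in \<open>N\<close>, so its tensor product with the field of two
  elements is its image in \<open>N\<^sub>2\<close>.
\<close>
definition sheaf_W1 :: "('m::finite, bit ^ 'm) sheaf"
  where "sheaf_W1 = \<lparr>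
    stalk = (\<lambda>(\<sigma>, Q). red2 ` {u \<in> lat_N. \<forall>t\<in>tangent_space \<sigma>. t \<bullet> u = 0}),
    trans_map = (\<lambda>e' e u. u)\<rparr>"

definition sheaf_N2 :: "('m::finite, bit ^ 'm) sheaf"
  where "sheaf_N2 = \<lparr>stalk = (\<lambda>e. UNIV), trans_map = (\<lambda>e' e u. u)\<rparr>"

text \<open>
  Simplicial cochains with values in \<open>bit\<close> are functions on simplices, a 0-cochain being evaluated
  at the singletons \<open>{v}\<close>.  A cochain of a simplex is extended by 0 to simplices outside of it.
\<close>
definition simp_cobd :: "((real ^ 'm) set \<Rightarrow> bit) \<Rightarrow> (real ^ 'm) set \<Rightarrow> bit"
  where "simp_cobd c \<tau> = (\<Sum>\<sigma> | \<sigma> facet_of \<tau>. c \<sigma>)"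

definition restrict_1cochain ::
    "(real ^ 'm) set \<Rightarrow> ((real ^ 'm) set \<Rightarrow> bit) \<Rightarrow> (real ^ 'm) set \<Rightarrow> bit"
  where "restrict_1cochain \<sigma> c = (\<lambda>s. if s edge_of \<sigma> then c s else 0)"

definition simp_Z1 :: "(real ^ 'm) set \<Rightarrow> ((real ^ 'm) set \<Rightarrow> bit) set"
  where "simp_Z1 \<sigma> = {c. (\<forall>s. \<not> s edge_of \<sigma> \<longrightarrow> c s = 0)
    \<and> (\<forall>\<tau>. \<tau> face_of \<sigma> \<and> aff_dim \<tau> = 2 \<longrightarrow> simp_cobd c \<tau> = 0)}"

definition sheaf_Z1 :: "('m::finite, (real ^ 'm) set \<Rightarrow> bit) sheaf"
  where "sheaf_Z1 = \<lparr>
    stalk = (\<lambda>(\<sigma>, Q). simp_Z1 \<sigma>),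
    trans_map = (\<lambda>e' e. restrict_1cochain (fst e))\<rparr>"

text \<open>On an edge with endpoints \<open>v\<^sub>0\<close>, \<open>v\<^sub>1\<close> the sum below is \<open>v\<^sub>0 + v\<^sub>1 = v\<^sub>0 - v\<^sub>1\<close> modulo 2.\<close>
definition z_map :: "'m::finite cell \<Rightarrow> bit ^ 'm \<Rightarrow> (real ^ 'm) set \<Rightarrow> bit"
  where "z_map e u = restrict_1cochain (fst e) (\<lambda>s. pairing2 (\<Sum>v\<in>vertices s. red2 v) u)"


section \<open>Hessians and \<open>\<rho>\<close>-uniformity\<close>

definition hessian ::
    "(real ^ 'm) set set \<Rightarrow> (real ^ 'm) set \<Rightarrow> ((real ^ 'm) set \<Rightarrow> bit) \<Rightarrow> ('m::finite cell \<Rightarrow> bit ^ 'm) set"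
  where "hessian K P \<epsilon> =
    connecting (cpx_X K P) sheaf_W1 sheaf_N2 (\<lambda>e u. u) z_map 0
      (section_class (cpx_X K P) sheaf_Z1 (\<lambda>e. restrict_1cochain (fst e) (simp_cobd \<epsilon>)))"

definition chi :: "real ^ 'm \<Rightarrow> (real ^ 'm) set \<Rightarrow> bit"
  where "chi v = (\<lambda>s. if s = {v} then 1 else 0)"

definition rho_uniform :: "(real ^ 'm) set set \<Rightarrow> (real ^ 'm) set \<Rightarrow> bool"
  where "rho_uniform K P \<longleftrightarrow>
    (\<exists>\<rho>\<in>cohomology (cpx_X0 K P) sheaf_W1 1. \<forall>v\<in>interior_vertices K P.
        restrict_class (dual_cell_boundary K P {v}) sheaf_W1 1 \<rho>
      = restrict_class (dual_cell_boundary K P {v}) sheaf_W1 1 (hessian K P (chi v)))"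

end

theory Submission
  imports Defs
begin

text \<open>
  Both conditions are statements about single interior facets \<open>\<sigma>\<close> (simplices of codimension 1
  that are not contained in \<open>\<partial>P\<close>), because the cohomology groups involved consist of cocycles.

  A cell \<open>[\<tau>, Q]\<close> for which \<open>\<tau>\<close> contains an interior vertex has \<open>Q = P\<close>.  Hence the 0-cells of \<open>X\<^sub>0\<close>
  and of \<open>\<partial>v\<^sup>*\<close> are the pairs of \<open>P\<close> and a full-dimensional simplex.  There \<open>\<W>\<^sub>1\<close> is zero, so there
  are no nonzero coboundaries in degree 1, and a class is the same as a cocycle: a family of elements
  of \<open>\<W>\<^sub>1(\<sigma>)\<close>, where \<open>\<sigma>\<close> runs through the facets with an interior vertex.

  The restriction of \<open>\<nabla>\<^sup>2\<chi>\<^sub>v\<close> to \<open>\<partial>v\<^sup>*\<close> is an explicit cocycle.  A primitive simplex has a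
  unimodular set of vertices (\<open>unimodular_simplex\<close>), so that every function \<open>f\<close> on its vertices with
  values modulo 2 extends uniquely to an affine function on \<open>M\<^sub>2\<close>, whose linear part in \<open>N\<^sub>2\<close> is
  called the gradient of \<open>f\<close>.  An interior facet \<open>\<sigma>\<close> lies in exactly two full-dimensional simplices
  (\<open>two_cofacets\<close>), and the value of \<open>\<nabla>\<^sup>2\<chi>\<^sub>v\<close> at \<open>\<sigma>\<close> is the jump of the gradient of \<open>\<chi>\<^sub>v\<close> across
  \<open>\<sigma>\<close>.  The jump annihilates \<open>T\<sigma>\<close> and is therefore determined by its value on \<open>v\<^sub>2 - w\<close>, where \<open>v\<^sub>2\<close> is
  one of the apices and \<open>w\<close> a vertex of \<open>\<sigma>\<close>; inserting the relation that defines \<open>\<rho>\<^sub>\<sigma>\<close> shows that this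
  value is \<open>\<rho>\<^sub>\<sigma>(v)\<close> (\<open>gradient_jump_eq_relation\<close>, \<open>jump_eq_iff_rho\<close>).

  So a class \<open>\<rho>\<close> that restricts to all the \<open>\<nabla>\<^sup>2\<chi>\<^sub>v\<close> makes \<open>\<rho>\<^sub>\<sigma>(v)\<close> independent of the interior vertex
  \<open>v\<close> of \<open>\<sigma>\<close>.  Conversely, if \<open>\<rho>\<^sub>\<sigma>(v)\<close> is independent of \<open>v\<close>, the cocycles on the various \<open>\<partial>v\<^sup>*\<close> agree on
  overlaps and glue to a cochain on \<open>X\<^sub>0\<close>.  It is a cocycle since every cell of \<open>X\<^sub>0\<close> lies in some
  \<open>\<partial>v\<^sup>*\<close> together with all its faces in \<open>X\<close>.
\<close>


section \<open>Volume and unimodularity of lattice simplices\<close>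

text \<open>
  A copy of the index type \<open>'m\<close> with a well-order, as it is needed for \<open>content_simplex\<close>.
\<close>
typedef ('m::finite) position = "{..<CARD('m)}"
  by (intro exI[of _ 0]) simp

instantiation position :: (finite) linorder
begin
definition less_eq_position :: "'a position \<Rightarrow> 'a position \<Rightarrow> bool"
  where "x \<le> y \<longleftrightarrow> Rep_position x \<le> Rep_position y"
definition less_position :: "'a position \<Rightarrow> 'a position \<Rightarrow> bool"
  where "x < y \<longleftrightarrow> Rep_position x < Rep_position y"
instance
  by standard (auto simp: less_eq_position_def less_position_def simp flip: Rep_position_inject)
end

instance position :: (finite) finite
proof
  have "(UNIV :: 'a position set) = Abs_position ` {..<CARD('a)}"
    by (rule type_definition.univ[OF type_definition_position])
  then show "finite (UNIV :: 'a position set)" by (metis finite_imageI finite_lessThan)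
qed

instance position :: (finite) wellorder
proof
  fix Q :: "'a position \<Rightarrow> bool" and x
  assume step: "\<And>x. (\<And>y. y < x \<Longrightarrow> Q y) \<Longrightarrow> Q x"
  show "Q x"
    by (induction x rule: measure_induct_rule[where f = Rep_position])
       (use step in \<open>auto simp: less_position_def\<close>)
qed

lemma card_position: "CARD('m::finite position) = CARD('m)"
  using type_definition.card[OF type_definition_position] by fastforce

lemma det_in_Ints:
  fixes A :: "real ^ 'k ^ 'k"
  assumes "\<And>i j. A $ i $ j \<in> \<int>"
  shows "det A \<in> \<int>"
  unfolding det_def using assms by (intro Ints_sum Ints_mult Ints_prod) auto

text \<open>The volume says that the edge vectors at \<open>x0\<close> form an integer matrix of determinant \<open>\<plusminus>1\<close>, and
  Cramer's rule then solves the linear equations for \<open>U\<close> in integers.\<close>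
lemma unimodular_simplex_wellorder:
  fixes X :: "(real ^ 'k::{finite,wellorder}) set" and g :: "real ^ ('k :: _) \<Rightarrow> int"
  assumes "finite X" "card X = Suc CARD('k)" "X \<subseteq> lat_M" "x0 \<in> X"
    and vol: "measure lborel (convex hull X) = 1 / fact CARD('k)"
  shows "\<exists>U\<in>lat_M. \<forall>x\<in>X. (x - x0) \<bullet> U = of_int (g x - g x0)"
proof -
  have "card (X - {x0}) = CARD('k)" using assms by simp
  then obtain f where f: "bij_betw f (UNIV :: 'k set) (X - {x0})"
    using finite_same_card_bij[of "UNIV :: 'k set" "X - {x0}"] assms(1) by auto
  define M where "M = (\<chi> i j. f j $ i - x0 $ i)"
  have "\<bar>det M\<bar> / fact CARD('k) = 1 / fact CARD('k)"
    using content_simplex[OF assms(1,2,4) f] vol unfolding M_def by simp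
  then have "\<bar>det M\<bar> = 1" by simp
  then have detM: "det M = 1 \<or> det M = - 1" by linarith
  define B where "B = transpose M"
  have fX: "f j \<in> X" for j using f by (auto simp: bij_betw_def)
  have B_int: "B $ i $ j \<in> \<int>" for i j
    using fX[of i] assms(3,4) by (auto simp: B_def M_def transpose_def lat_M_def subset_iff intro!: Ints_diff)
  define b where "b = (\<chi> j. real_of_int (g (f j) - g x0))"
  define U where "U = (\<chi> k. det (\<chi> i j. if j = k then b $ i else B $ i $ j) / det B)"
  have detB: "det B = 1 \<or> det B = - 1" unfolding B_def using detM by simp
  have "B *v U = b" using cramer[of B U b] detB unfolding U_def by auto
  have "U \<in> lat_M"
  proof -
    have "det (\<chi> i j. if j = k then b $ i else B $ i $ j) \<in> \<int>" for k
      by (rule det_in_Ints) (auto simp: B_int b_def)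
    then show ?thesis using detB by (auto simp: lat_M_def U_def)
  qed
  moreover have "(x - x0) \<bullet> U = of_int (g x - g x0)" if "x \<in> X" for x
  proof (cases "x = x0")
    case False
    then have "x \<in> range f" using f that by (simp add: bij_betw_def)
    then obtain j where "x = f j" by blast
    moreover have "(f j - x0) \<bullet> U = (B *v U) $ j"
      by (simp add: B_def M_def transpose_def matrix_vector_mult_def inner_vec_def)
    ultimately show ?thesis unfolding \<open>B *v U = b\<close> by (simp add: b_def)
  qed auto
  ultimately show ?thesis by blast
qed

text \<open>Lebesgue measure is determined by the volumes of boxes, and a renaming of the coordinates only
  permutes the side lengths of a box.\<close>
lemma measure_reindex:
  fixes \<phi> :: "'k::finite \<Rightarrow> 'm::finite" and S :: "(real ^ 'm) set"
  assumes "bij \<phi>" and "compact S"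
  shows "measure lborel ((\<lambda>x. \<chi> k. x $ \<phi> k) ` S) = measure lborel S"
proof -
  define h :: "real ^ 'k \<Rightarrow> real ^ 'm" where "h = (\<lambda>y. \<chi> i. y $ inv \<phi> i)"
  have lin: "linear h" unfolding h_def by (auto simp: linear_iff vec_eq_iff)
  have [measurable]: "h \<in> borel_measurable borel"
    using lin by (intro borel_measurable_continuous_onI linear_continuous_on) (auto simp: linear_conv_bounded_linear)
  have hinv: "h (\<chi> k. x $ \<phi> k) = x" "(\<chi> k. h y $ \<phi> k) = y" for x y
    using assms(1) by (simp_all add: h_def vec_eq_iff bij_is_surj surj_f_inv_f bij_is_inj)
  have "lborel = distr lborel borel h"
  proof (rule lborel_eqI)
    fix l u :: "real ^ 'm"
    assume lu: "\<And>b. b \<in> Basis \<Longrightarrow> l \<bullet> b \<le> u \<bullet> b"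
    then have lu': "l $ i \<le> u $ i" for i
      by (metis axis_in_Basis_iff cart_eq_inner_axis real_inner_1_right Basis_real_def singletonI)
    have "h -` box l u = box (\<chi> k. l $ \<phi> k) (\<chi> k. u $ \<phi> k)"
    proof -
      have "(\<forall>i. Q i) \<longleftrightarrow> (\<forall>k. Q (\<phi> k))" for Q
        using assms(1) by (metis bij_pointE)
      note all = this
      have "h y $ \<phi> k = y $ k" for y k using hinv(2)[of y] by (simp add: vec_eq_iff)
      then show ?thesis by (auto simp: mem_box_cart all[of "\<lambda>i. l $ i < h _ $ i \<and> h _ $ i < u $ i"]
            all[of "\<lambda>i. l $ i < h _ $ i"] all[of "\<lambda>i. h _ $ i < u $ i"])
    qed
    then have "emeasure (distr lborel borel h) (box l u) =
        emeasure lborel (box (\<chi> k. l $ \<phi> k) (\<chi> k. u $ \<phi> k))"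
      by (simp add: emeasure_distr)
    also have "\<dots> = (\<Prod>b\<in>Basis. ((\<chi> k. u $ \<phi> k) - (\<chi> k. l $ \<phi> k)) \<bullet> b)"
      by (rule emeasure_lborel_box) (auto simp: Basis_vec_def inner_axis lu')
    also have "(\<Prod>b\<in>Basis. ((\<chi> k. u $ \<phi> k) - (\<chi> k. l $ \<phi> k)) \<bullet> b) = (\<Prod>k\<in>UNIV. (u - l) $ \<phi> k)"
    proof -
      have "bij_betw (\<lambda>k. axis k (1::real)) UNIV (Basis :: (real ^ 'k) set)"
        by (auto simp: bij_betw_def inj_on_def Basis_vec_def axis_eq_axis)
      then show ?thesis by (subst prod.reindex_bij_betw[symmetric]) (auto simp: inner_axis)
    qed
    also have "(\<Prod>k\<in>UNIV. (u - l) $ \<phi> k) = (\<Prod>i\<in>UNIV. (u - l) $ i)"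
      using prod.reindex_bij_betw[OF assms(1)] .
    also have "\<dots> = (\<Prod>b\<in>Basis. (u - l) \<bullet> b)"
    proof -
      have "bij_betw (\<lambda>k. axis k (1::real)) UNIV (Basis :: (real ^ 'm) set)"
        by (auto simp: bij_betw_def inj_on_def Basis_vec_def axis_eq_axis)
      then show ?thesis by (subst prod.reindex_bij_betw[symmetric]) (auto simp: inner_axis)
    qed
    finally show "emeasure (distr lborel borel h) (box l u) = (\<Prod>b\<in>Basis. (u - l) \<bullet> b)" .
  qed simp
  then have "measure lborel S = measure (distr lborel borel h) S" by simp
  also have "\<dots> = measure lborel (h -` S)"
    using compact_imp_closed[OF assms(2)] by (subst measure_distr) auto
  also have "h -` S = (\<lambda>x. \<chi> k. x $ \<phi> k) ` S"
    using hinv by (auto simp: image_iff) metis+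
  finally show ?thesis by simp
qed

lemma unimodular_simplex:
  fixes X :: "(real ^ 'm) set" and g :: "real ^ 'm \<Rightarrow> int"
  assumes X: "finite X" "card X = Suc CARD('m)" "X \<subseteq> lat_M" "x0 \<in> X"
    and vol: "measure lebesgue (convex hull X) = 1 / fact CARD('m)"
  shows "\<exists>U\<in>lat_M. \<forall>x\<in>X. (x - x0) \<bullet> U = of_int (g x - g x0)"
proof -
  obtain \<phi> :: "'m position \<Rightarrow> 'm" where \<phi>: "bij \<phi>"
    using finite_same_card_bij[of "UNIV :: 'm position set" "UNIV :: 'm set"] card_position by auto
  define h :: "real ^ 'm \<Rightarrow> real ^ 'm position" where "h = (\<lambda>x. \<chi> k. x $ \<phi> k)"
  have "inj h" using \<phi> by (auto simp: inj_def h_def vec_eq_iff) (metis bij_pointE)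
  have lin: "linear h" unfolding h_def by (auto simp: linear_iff vec_eq_iff)
  have comp: "compact (convex hull X)" using X by (simp add: finite_imp_compact_convex_hull)
  have "measure lborel (convex hull (h ` X)) = measure lborel (h ` (convex hull X))"
    using convex_hull_linear_image[OF lin] by simp
  also have "\<dots> = measure lborel (convex hull X)"
    unfolding h_def by (rule measure_reindex[OF \<phi> comp])
  also have "\<dots> = 1 / fact CARD('m)"
    using vol comp by (simp add: compact_imp_closed)
  finally have vol': "measure lborel (convex hull (h ` X)) = 1 / fact CARD('m position)"
    by (simp add: card_position)
  have "h ` X \<subseteq> lat_M" using X(3) by (auto simp: lat_M_def h_def)
  moreover have "card (h ` X) = Suc CARD('m position)"
    using X \<open>inj h\<close> by (simp add: card_image inj_on_subset card_position)
  ultimately obtain U where U: "U \<in> lat_M" "\<forall>x\<in>h ` X. (x - h x0) \<bullet> U = of_int (g (inv h x) - g (inv h (h x0)))"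
    using unimodular_simplex_wellorder[of "h ` X" "h x0" "\<lambda>y. g (inv h y)"] X vol' by auto
  define U' where "U' = (\<chi> i. U $ inv \<phi> i)"
  have "x \<bullet> U' = h x \<bullet> U" for x
  proof -
    have "x \<bullet> U' = (\<Sum>i\<in>UNIV. x $ i * U $ inv \<phi> i)" by (simp add: U'_def inner_vec_def)
    also have "\<dots> = (\<Sum>k\<in>UNIV. x $ \<phi> k * U $ inv \<phi> (\<phi> k))"
      using sum.reindex_bij_betw[OF \<phi>, of "\<lambda>i. x $ i * U $ inv \<phi> i"] by simp
    finally show ?thesis using \<phi> by (simp add: h_def inner_vec_def bij_is_inj)
  qed
  then have "(x - x0) \<bullet> U' = of_int (g x - g x0)" if "x \<in> X" for x
    using U(2) that \<open>inj h\<close> linear_diff[OF lin] by (auto simp: inv_f_f)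
  moreover have "U' \<in> lat_M" using U(1) by (auto simp: U'_def lat_M_def)
  ultimately show ?thesis by blast
qed


section \<open>Affine functions modulo 2 on a unimodular set\<close>

(* These rules turn sums and products of bits into case distinctions. *)
declare add_bit_eq_xor [simp del] mult_bit_eq_and [simp del]

lemma bit_add_self [simp]: "(a :: bit) + a = 0" "a + (a + b) = b"
  by (cases a; simp flip: add.assoc)+

lemma bit_move: "(a :: bit) + b = c + d \<Longrightarrow> a = c + (d + b)"
  by (cases a; cases b; cases c; cases d) auto

lemma bit_vec_add_self [simp]: "(x :: bit ^ 'm) + x = 0"
  by (simp add: vec_eq_iff)

text \<open>There are no signs over the field with two elements; below, differences are written as sums.\<close>
lemma bit_vec_diff: "(x :: bit ^ 'm) - y = x + y"
  by (simp add: vec_eq_iff)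

lemma bit_vec_add_left_self [simp]: "(x :: bit ^ 'm) + (x + y) = y"
  by (simp add: vec_eq_iff flip: add.assoc)

lemma bit_eq_iff_add: "(a :: bit) = b \<longleftrightarrow> a + b = 0"
  by (cases a; cases b) auto

lemma bit_vec_eq_iff_add: "(x :: bit ^ 'm) = y \<longleftrightarrow> x + y = 0"
  by (simp add: vec_eq_iff bit_eq_iff_add[of "x $ _"])

lemma pairing2_add_left: "pairing2 (x + y) u = pairing2 x u + pairing2 y u"
  by (simp add: pairing2_def distrib_right sum.distrib)

lemma pairing2_add_right: "pairing2 x (u + w) = pairing2 x u + pairing2 x w"
  by (simp add: pairing2_def distrib_left sum.distrib)

lemma pairing2_zero [simp]: "pairing2 0 u = 0" "pairing2 x 0 = 0"
  by (simp_all add: pairing2_def)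

lemma pairing2_smult: "pairing2 (c *s x) u = c * pairing2 x u"
  by (simp add: pairing2_def sum_distrib_left mult.assoc)

lemma pairing2_sum: "pairing2 (\<Sum>i\<in>A. x i) u = (\<Sum>i\<in>A. pairing2 (x i) u)"
  by (induction A rule: infinite_finite_induct) (auto simp: pairing2_add_left)

lemma pairing2_axis: "pairing2 (axis i 1) u = u $ i"
proof -
  have "pairing2 (axis i 1) u = (\<Sum>j\<in>UNIV. if j = i then u $ j else 0)"
    unfolding pairing2_def by (intro sum.cong) (auto simp: axis_def)
  then show ?thesis by simp
qed

lemma lat_M_component: "x \<in> lat_M \<Longrightarrow> x $ i = of_int \<lfloor>x $ i\<rfloor>"
  by (auto simp: lat_M_def elim!: Ints_cases)

lemma lat_M_sum_scaleR:
  assumes "\<And>w. w \<in> X \<Longrightarrow> w \<in> lat_M \<and> c w \<in> \<int>"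
  shows "(\<Sum>w\<in>X. c w *\<^sub>R w) \<in> lat_M"
  using assms by (auto simp: lat_M_def intro!: Ints_sum Ints_mult)

lemma red2_add:
  assumes "x \<in> lat_M" "y \<in> lat_M"
  shows "red2 (x + y) = red2 x + red2 y"
proof -
  have "\<lfloor>x $ i + y $ i\<rfloor> = \<lfloor>x $ i\<rfloor> + \<lfloor>y $ i\<rfloor>" for i
    using assms by (subst lat_M_component[of x], simp, subst lat_M_component[of y]) auto
  then show ?thesis by (simp add: red2_def vec_eq_iff)
qed

lemma lat_M_diff: "a \<in> lat_M \<Longrightarrow> b \<in> lat_M \<Longrightarrow> a - b \<in> lat_M"
  by (auto simp: lat_M_def)

lemma red2_diff:
  assumes "a \<in> lat_M" "b \<in> lat_M"
  shows "red2 (a - b) = red2 a + red2 b"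
proof -
  have "red2 a = red2 (a - b) + red2 b"
    using red2_add[OF lat_M_diff[OF assms] assms(2)] by simp
  then show ?thesis by (simp add: add.assoc)
qed
lemma red2_sum_scaleR:
  assumes "finite X" "\<And>w. w \<in> X \<Longrightarrow> w \<in> lat_M \<and> c w \<in> \<int>"
  shows "red2 (\<Sum>w\<in>X. c w *\<^sub>R w) = (\<Sum>w\<in>X. of_int \<lfloor>c w\<rfloor> *s red2 w)"
  using assms
proof (induction X rule: finite_induct)
  case (insert v X)
  have "\<lfloor>c v * v $ i\<rfloor> = \<lfloor>c v\<rfloor> * \<lfloor>v $ i\<rfloor>" for i
    using insert.prems[of v] lat_M_component[of v i] by (auto elim!: Ints_cases) (metis floor_of_int of_int_mult)
  then have "red2 (c v *\<^sub>R v) = of_int \<lfloor>c v\<rfloor> *s red2 v"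
    by (simp add: red2_def vec_eq_iff)
  moreover have "red2 (c v *\<^sub>R v + (\<Sum>w\<in>X. c w *\<^sub>R w)) = red2 (c v *\<^sub>R v) + red2 (\<Sum>w\<in>X. c w *\<^sub>R w)"
    using insert.prems lat_M_sum_scaleR[of "{v}" c] by (intro red2_add lat_M_sum_scaleR) auto
  ultimately show ?case using insert by simp
qed (simp add: red2_def vec_eq_iff)

lemma pairing2_red2:
  assumes "x \<in> lat_M" "u \<in> lat_M"
  shows "pairing2 (red2 x) (red2 u) = of_int \<lfloor>x \<bullet> u\<rfloor>"
proof -
  have "x \<bullet> u = of_int (\<Sum>i\<in>UNIV. \<lfloor>x $ i\<rfloor> * \<lfloor>u $ i\<rfloor>)"
    by (simp add: inner_vec_def flip: lat_M_component[OF assms(1)] lat_M_component[OF assms(2)])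
  then have "\<lfloor>x \<bullet> u\<rfloor> = (\<Sum>i\<in>UNIV. \<lfloor>x $ i\<rfloor> * \<lfloor>u $ i\<rfloor>)" by (simp only: floor_of_int)
  then show ?thesis by (simp add: pairing2_def red2_def)
qed

lemma red2_surj: "\<exists>x\<in>lat_M. red2 x = y"
proof -
  have "red2 (\<chi> i. of_bool (y $ i = 1)) = y"
    by (auto simp: red2_def vec_eq_iff of_bool_def)
  then show ?thesis by (intro bexI[of _ "\<chi> i. of_bool (y $ i = 1)"]) (auto simp: lat_M_def)
qed

lemma lat_N_eq: "lat_N = lat_M"
proof
  show "lat_N \<subseteq> lat_M"
  proof
    fix u :: "real ^ 'm" assume "u \<in> lat_N"
    then have "axis i 1 \<bullet> u \<in> \<int>" for i
      by (auto simp: lat_N_def lat_M_def axis_def)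
    then show "u \<in> lat_M" by (simp add: lat_M_def inner_axis')
  qed
qed (auto simp: lat_N_def lat_M_def inner_vec_def intro!: Ints_sum Ints_mult)


text \<open>A vertex set such that the differences with one of its elements form a basis of the lattice.  This is
  expressed by duality: every integer function on \<open>X\<close> extends to an integral affine function.\<close>
definition unimodular :: "(real ^ 'm) set \<Rightarrow> bool"
  where "unimodular X \<longleftrightarrow> finite X \<and> X \<subseteq> lat_M \<and> affine hull X = UNIV
    \<and> (\<forall>x0\<in>X. \<forall>g :: real ^ 'm \<Rightarrow> int. \<exists>U\<in>lat_M. \<forall>x\<in>X. (x - x0) \<bullet> U = of_int (g x - g x0))"

text \<open>The linear form \<open>u\<close> is the linear part of an affine function on \<open>M\<^sub>2\<close> that restricts to \<open>f\<close> on \<open>S\<close>.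
  For the vertices \<open>S\<close> of a simplex this is the equation \<open>z(u) = df\<close>, and for \<open>f = 0\<close> it says that
  \<open>u\<close> annihilates the tangent space modulo 2.\<close>
definition gradient2 :: "(real ^ 'm) set \<Rightarrow> (real ^ 'm \<Rightarrow> bit) \<Rightarrow> bit ^ 'm \<Rightarrow> bool"
  where "gradient2 S f u \<longleftrightarrow> (\<forall>a\<in>S. \<forall>b\<in>S. pairing2 (red2 a + red2 b) u = f a + f b)"

lemma gradient2_subset: "gradient2 S f u \<Longrightarrow> T \<subseteq> S \<Longrightarrow> gradient2 T f u"
  by (auto simp: gradient2_def)

lemma gradient2_add: "gradient2 S f u \<Longrightarrow> gradient2 S g w \<Longrightarrow> gradient2 S (\<lambda>x. f x + g x) (u + w)"
  by (simp add: gradient2_def pairing2_add_right)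

lemma gradient2_0: "gradient2 S (\<lambda>x. 0) 0"
  by (simp add: gradient2_def)

lemma gradient2_sum:
  assumes "\<And>i. i \<in> I \<Longrightarrow> gradient2 S (\<lambda>x. 0) (u i)"
  shows "gradient2 S (\<lambda>x. 0) (sum u I)"
  using assms
proof (induction I rule: infinite_finite_induct)
  case (insert i I)
  then show ?case using gradient2_add[of S "\<lambda>x. 0" "u i" "\<lambda>x. 0" "sum u I"] by simp
qed (simp_all add: gradient2_0)
text \<open>On \<open>S\<close> the form \<open>u\<close> is \<open>f\<close> plus a constant, and the constant cancels because the coefficients of the
  relation add up to 0.\<close>
lemma pairing2_gradient2:
  assumes "finite S" "gradient2 S f u" "(\<Sum>w\<in>S. r w) = 0"
  shows "pairing2 (\<Sum>w\<in>S. r w *s red2 w) u = (\<Sum>w\<in>S. r w * f w)"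
proof (cases "S = {}")
  case False
  then obtain a where a: "a \<in> S" by blast
  have "pairing2 (red2 w) u = f w + (pairing2 (red2 a) u + f a)" if "w \<in> S" for w
    using assms(2) a that unfolding gradient2_def pairing2_add_left
    by (subst bit_move[of _ "pairing2 (red2 a) u" "f w" "f a"]) (auto simp: ac_simps)
  then have "pairing2 (\<Sum>w\<in>S. r w *s red2 w) u = (\<Sum>w\<in>S. r w * f w + r w * (pairing2 (red2 a) u + f a))"
    unfolding pairing2_sum pairing2_smult by (intro sum.cong) (auto simp: distrib_left)
  also have "\<dots> = (\<Sum>w\<in>S. r w * f w) + (\<Sum>w\<in>S. r w) * (pairing2 (red2 a) u + f a)"
    by (simp add: sum.distrib sum_distrib_right)
  finally show ?thesis using assms(3) by simp
qed simp

text \<open>Lifting the values of \<open>f\<close> to the integers 0 and 1 gives an integral form.  It does not only reduce to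
  a gradient of \<open>f\<close>: it vanishes on differences of points where \<open>f\<close> takes the same value.  This is what
  lifts an element of \<open>N\<^sub>2\<close> that kills a face to an element of \<open>N\<close> that kills the face.\<close>
lemma unimodular_gradient2_lift:
  fixes X :: "(real ^ 'm) set"
  assumes "unimodular X"
  obtains U where "U \<in> lat_M" "gradient2 X f (red2 U)"
    "\<And>a b. a \<in> X \<Longrightarrow> b \<in> X \<Longrightarrow> f a = f b \<Longrightarrow> (a - b) \<bullet> U = 0"
proof (cases "X = {}")
  case True
  then show ?thesis using that[of 0] by (auto simp: lat_M_def gradient2_def)
next
  case False
  then obtain x0 where x0: "x0 \<in> X" by blast
  define g :: "real ^ 'm \<Rightarrow> int" where "g x = (if f x = 1 then 1 else 0)" for x
  have fin: "finite X" "X \<subseteq> lat_M" using assms by (auto simp: unimodular_def)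
  obtain U where U: "U \<in> lat_M" "\<And>x. x \<in> X \<Longrightarrow> (x - x0) \<bullet> U = of_int (g x - g x0)"
    using assms x0 unfolding unimodular_def by metis
  have diff: "(a - b) \<bullet> U = of_int (g a - g b)" if "a \<in> X" "b \<in> X" for a b
    using U(2)[OF that(1)] U(2)[OF that(2)] by (simp add: inner_diff_left)
  have "pairing2 (red2 a + red2 b) (red2 U) = f a + f b" if "a \<in> X" "b \<in> X" for a b
  proof -
    have lat: "a \<in> lat_M" "b \<in> lat_M" using that fin by auto
    have "pairing2 (red2 a + red2 b) (red2 U) = of_int (g a - g b)"
      using pairing2_red2[OF lat_M_diff[OF lat] U(1)] by (simp add: diff[OF that] red2_diff[OF lat])
    also have "\<dots> = f a + f b" by (cases "f a"; cases "f b") (auto simp: g_def)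
    finally show ?thesis .
  qed
  then show ?thesis using that[of U] U(1) diff by (auto simp: gradient2_def g_def)
qed

text \<open>The real affine coordinates of a lattice point are the values of the integral forms that are dual to
  \<open>X\<close>, hence integers, and can be reduced modulo 2.\<close>
lemma unimodular_expansion:
  fixes y :: "bit ^ 'm"
  assumes "unimodular X"
  obtains r where "\<forall>v. v \<notin> X \<longrightarrow> r v = 0" "(\<Sum>w\<in>X. r w) = 0" "(\<Sum>w\<in>X. r w *s red2 w) = y"
proof -
  have fin: "finite X" "X \<subseteq> lat_M" "affine hull X = UNIV" using assms by (auto simp: unimodular_def)
  have "X \<noteq> {}" using fin(3) by auto
  then obtain x0 where x0: "x0 \<in> X" by blast
  obtain Y where Y: "Y \<in> lat_M" "red2 Y = y" using red2_surj by blast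
  obtain c where c: "sum c X = 1" "(\<Sum>w\<in>X. c w *\<^sub>R w) = Y + x0"
    using affine_hull_finite[OF fin(1)] fin(3) by blast
  have cZ: "c v \<in> \<int>" if v: "v \<in> X" for v
  proof -
    obtain U where U: "U \<in> lat_M" "\<And>x. x \<in> X \<Longrightarrow> (x - x0) \<bullet> U = of_int (of_bool (x = v) - of_bool (x0 = v))"
      using assms[unfolded unimodular_def] x0
      by (elim conjE ballE[of _ _ x0] allE[of _ "\<lambda>x. of_bool (x = v)"]) (auto simp: of_bool_def)
    have "Y = (\<Sum>w\<in>X. c w *\<^sub>R w) - sum c X *\<^sub>R x0" using c by simp
    also have "\<dots> = (\<Sum>w\<in>X. c w *\<^sub>R (w - x0))"
      by (simp add: scaleR_sum_left scaleR_diff_right sum_subtractf)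
    finally have "Y \<bullet> U = (\<Sum>w\<in>X. c w * (of_bool (w = v) - of_bool (x0 = v)))"
      by (simp add: inner_sum_left U(2))
    also have "\<dots> = (\<Sum>w\<in>X. if w = v then c w else 0) - sum c X * of_bool (x0 = v)"
      unfolding sum_distrib_right sum_subtractf[symmetric] by (intro sum.cong) auto
    also have "\<dots> = c v - of_bool (x0 = v)" using c(1) fin(1) v by simp
    finally have "c v = Y \<bullet> U + of_bool (x0 = v)" by simp
    moreover have "Y \<bullet> U \<in> \<int>"
      using Y(1) U(1) by (auto simp: lat_M_def inner_vec_def intro!: Ints_sum Ints_mult)
    ultimately show ?thesis by simp
  qed
  \<comment> \<open>The coordinates of \<open>Y + x0\<close> add up to 1; adding 1 at \<open>x0\<close> moves from \<open>Y + x0\<close> back to \<open>Y\<close>.\<close>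
  define r where "r w = (if w \<in> X then of_int \<lfloor>c w\<rfloor> + of_bool (w = x0) else (0::bit))" for w
  have "(\<Sum>w\<in>X. r w) = of_int (\<Sum>w\<in>X. \<lfloor>c w\<rfloor>) + 1"
    using x0 fin(1) by (simp add: r_def sum.distrib of_bool_def)
  also have "(\<Sum>w\<in>X. \<lfloor>c w\<rfloor>) = 1"
  proof -
    have "real_of_int (\<Sum>w\<in>X. \<lfloor>c w\<rfloor>) = (\<Sum>w\<in>X. c w)"
      unfolding of_int_sum using cZ by (intro sum.cong) (auto elim!: Ints_cases)
    then show ?thesis using c(1) by linarith
  qed
  finally have r0: "(\<Sum>w\<in>X. r w) = 0" by simp
  have "(\<Sum>w\<in>X. r w *s red2 w)
      = (\<Sum>w\<in>X. of_int \<lfloor>c w\<rfloor> *s red2 w) + (\<Sum>w\<in>X. if w = x0 then red2 w else 0)"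
    unfolding sum.distrib[symmetric] by (intro sum.cong) (auto simp: r_def vec_eq_iff distrib_right)
  also have "(\<Sum>w\<in>X. of_int \<lfloor>c w\<rfloor> *s red2 w) = red2 (Y + x0)"
    unfolding c(2)[symmetric] using fin cZ by (intro red2_sum_scaleR[symmetric]) auto
  also have "\<dots> = y + red2 x0" using Y x0 fin by (subst red2_add) auto
  finally have "(\<Sum>w\<in>X. r w *s red2 w) = y"
    using x0 fin(1) by (simp add: add.assoc)
  with r0 show ?thesis using that[of r] by (simp add: r_def)
qed

lemma unimodular_gradient2_unique:
  assumes "unimodular X" "gradient2 X f u" "gradient2 X f w"
  shows "u = w"
proof -
  have "u $ i = w $ i" for i
  proof -
    obtain r where r: "(\<Sum>w\<in>X. r w) = 0" "(\<Sum>w\<in>X. r w *s red2 w) = axis i 1"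
      using unimodular_expansion[OF assms(1)] by metis
    have "finite X" using assms(1) by (simp add: unimodular_def)
    from pairing2_gradient2[OF this assms(2) r(1)] pairing2_gradient2[OF this assms(3) r(1)]
    show ?thesis by (simp add: r(2) pairing2_axis)
  qed
  then show ?thesis by (simp add: vec_eq_iff)
qed

lemma unimodular_kernel_trivial:
  "unimodular X \<Longrightarrow> gradient2 X (\<lambda>x. 0) u \<Longrightarrow> u = 0"
  using unimodular_gradient2_unique gradient2_0 by blast

text \<open>Pair the relation with the gradient of the indicator function of \<open>v\<close>.\<close>
lemma unimodular_relation_trivial:
  assumes "unimodular X" "S \<subseteq> X" "(\<Sum>w\<in>S. r w) = 0" "(\<Sum>w\<in>S. r w *s red2 w) = 0" "v \<in> S"
  shows "r v = 0"
proof -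
  obtain U where U: "gradient2 X (\<lambda>x. of_bool (x = v)) (red2 U)"
    using unimodular_gradient2_lift[OF assms(1)] by metis
  have "finite S" using assms(1,2) finite_subset by (auto simp: unimodular_def)
  with pairing2_gradient2[OF this gradient2_subset[OF U assms(2)] assms(3)] assms(4,5)
  show ?thesis by (simp add: pairing2_def)
qed

text \<open>Modulo differences of elements of \<open>S\<close>, on which \<open>k\<close> vanishes, all \<open>v - b\<close> with \<open>b\<close> in \<open>S\<close> are equal.\<close>
lemma gradient2_insert_0:
  assumes "gradient2 S (\<lambda>x. 0) k" "w \<in> S" "pairing2 (red2 v + red2 w) k = 0"
  shows "gradient2 (insert v S) (\<lambda>x. 0) k"
proof -
  have "pairing2 (red2 v + red2 b) k = 0" if "b \<in> S" for b
  proof -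
    have "red2 v + red2 b = (red2 v + red2 w) + (red2 w + red2 b)" by (simp add: add.assoc)
    then have "pairing2 (red2 v + red2 b) k = pairing2 (red2 v + red2 w) k + pairing2 (red2 w + red2 b) k"
      by (simp only: pairing2_add_left)
    then show ?thesis using assms that by (simp add: gradient2_def)
  qed
  then show ?thesis using assms(1) by (auto simp: gradient2_def add.commute[of _ "red2 v"])
qed

text \<open>This is the relation that defines \<open>\<rho>\<^sub>\<sigma>\<close>.  Expand \<open>v1 - v2\<close> in the affine coordinates of the first
  simplex; the point is that \<open>v1\<close> has coefficient 0.  That coefficient is the value on \<open>v1 - v2\<close> of the
  gradient \<open>k\<close> of the indicator function of \<open>v1\<close>.  As \<open>k\<close> is nonzero and kills \<open>S\<close>, it cannot kill
  either simplex, so it is 1 on \<open>v1 - w\<close> and on \<open>v2 - w\<close>, and the two cancel.\<close>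
lemma apex_relation:
  fixes S :: "(real ^ 'm) set"
  assumes X: "unimodular (insert v1 S)" "unimodular (insert v2 S)" and v: "v1 \<notin> S" and "S \<noteq> {}"
  shows "\<exists>!r. (\<forall>v. v \<notin> S \<longrightarrow> r v = 0) \<and> (\<Sum>w\<in>S. r w) = 0 \<and> (\<Sum>w\<in>S. r w *s red2 w) = red2 v1 + red2 v2"
proof (rule ex_ex1I)
  obtain w where w: "w \<in> S" using \<open>S \<noteq> {}\<close> by blast
  have fin: "finite S" using X by (simp add: unimodular_def)
  obtain r where r: "\<forall>v. v \<notin> insert v1 S \<longrightarrow> r v = 0" "(\<Sum>w\<in>insert v1 S. r w) = 0"
    "(\<Sum>w\<in>insert v1 S. r w *s red2 w) = red2 v1 + red2 v2"
    by (rule unimodular_expansion[OF X(1), of "red2 v1 + red2 v2"])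
  obtain U where U: "gradient2 (insert v1 S) (\<lambda>x. of_bool (x = v1)) (red2 U)"
    by (rule unimodular_gradient2_lift[OF X(1)])
  define k where "k = red2 U"
  have k1: "pairing2 (red2 v1 + red2 w) k = 1"
    using U w v by (auto simp: gradient2_def k_def)
  have kS: "gradient2 S (\<lambda>x. 0) k" using U v by (auto simp: gradient2_def k_def)
  have k2: "pairing2 (red2 v2 + red2 w) k = 1"
  proof (rule ccontr)
    assume "pairing2 (red2 v2 + red2 w) k \<noteq> 1"
    then have "gradient2 (insert v2 S) (\<lambda>x. 0) k"
      using gradient2_insert_0[OF kS w] by simp
    then have "k = 0" using unimodular_kernel_trivial[OF X(2)] by blast
    then show False using k1 by simp
  qed
  have "pairing2 (red2 v1 + red2 v2) k = pairing2 ((red2 v1 + red2 w) + (red2 v2 + red2 w)) k"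
    by (simp add: add.assoc add.left_commute add.commute)
  then have "pairing2 (red2 v1 + red2 v2) k = 0"
    by (simp only: pairing2_add_left[of "red2 v1 + red2 w"] k1 k2) simp
  then have "(\<Sum>w\<in>insert v1 S. r w * of_bool (w = v1)) = 0"
    using pairing2_gradient2[OF _ U r(2)] fin by (simp add: r(3) k_def)
  also have "(\<Sum>w\<in>insert v1 S. r w * of_bool (w = v1)) = r v1"
    using fin v by simp
  finally have "r v1 = 0" .
  then show "\<exists>r. (\<forall>v. v \<notin> S \<longrightarrow> r v = 0) \<and> (\<Sum>w\<in>S. r w) = 0 \<and> (\<Sum>w\<in>S. r w *s red2 w) = red2 v1 + red2 v2"
    using r fin v by (intro exI[of _ r]) auto
next
  fix r r' :: "real ^ 'm \<Rightarrow> bit"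
  assume r: "(\<forall>v. v \<notin> S \<longrightarrow> r v = 0) \<and> (\<Sum>w\<in>S. r w) = 0 \<and> (\<Sum>w\<in>S. r w *s red2 w) = red2 v1 + red2 v2"
    and r': "(\<forall>v. v \<notin> S \<longrightarrow> r' v = 0) \<and> (\<Sum>w\<in>S. r' w) = 0 \<and> (\<Sum>w\<in>S. r' w *s red2 w) = red2 v1 + red2 v2"
  have "r v + r' v = 0" if "v \<in> S" for v
  proof (rule unimodular_relation_trivial[OF X(1) _ _ _ that])
    show "(\<Sum>w\<in>S. r w + r' w) = 0" using r r' by (simp add: sum.distrib)
    have "(\<Sum>w\<in>S. (r w + r' w) *s red2 w) = (\<Sum>w\<in>S. r w *s red2 w) + (\<Sum>w\<in>S. r' w *s red2 w)"
      by (simp add: vec.scale_left_distrib sum.distrib)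
    then show "(\<Sum>w\<in>S. (r w + r' w) *s red2 w) = 0" using r r' by simp
  qed auto
  then have "r v = r' v" if "v \<in> S" for v using that bit_eq_iff_add by blast
  then show "r = r'" using r r' by (intro ext) metis
qed

text \<open>Over \<open>v2 - w\<close> the gradient \<open>u2\<close> is known from the second simplex.  To evaluate \<open>u1\<close>, pass from \<open>v2\<close> to
  \<open>v1\<close> by the relation, whose terms all lie in \<open>S\<close>, and then use the first simplex.\<close>
lemma gradient_jump_eq_relation:
  assumes u1: "gradient2 (insert v1 S) f u1" and u2: "gradient2 (insert v2 S) f u2"
    and w: "w \<in> S" and "finite S"
    and r: "(\<Sum>w\<in>S. r w) = 0" "(\<Sum>w\<in>S. r w *s red2 w) = red2 v1 + red2 v2"
  shows "pairing2 (red2 v2 + red2 w) (u1 + u2) = (\<Sum>w\<in>S. r w * f w) + f v1 + f v2"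
proof -
  have "pairing2 (red2 v2 + red2 w) u1 = pairing2 ((red2 v1 + red2 w) + (red2 v1 + red2 v2)) u1"
    by (simp add: add.assoc add.left_commute add.commute)
  also have "\<dots> = f v1 + f w + (\<Sum>w\<in>S. r w * f w)"
    using pairing2_gradient2[OF \<open>finite S\<close> gradient2_subset[OF u1] r(1)] u1 w
    by (simp only: pairing2_add_left[of "red2 v1 + red2 w"] r(2)[symmetric]) (auto simp: gradient2_def)
  finally have "pairing2 (red2 v2 + red2 w) (u1 + u2) = f v1 + f w + (\<Sum>w\<in>S. r w * f w) + (f v2 + f w)"
    using u2 w by (simp add: pairing2_add_right gradient2_def)
  also have "\<dots> = (\<Sum>w\<in>S. r w * f w) + f v1 + f v2"
    by (simp add: ac_simps)
  finally show ?thesis .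
qed


section \<open>Facets in the interior of a triangulated polytope\<close>

lemma vertices_convex_hull: "\<not> affine_dependent C \<Longrightarrow> vertices (convex hull C) = C"
  by (auto simp: vertices_def extreme_point_of_convex_hull_affine_independent)

lemma simplex_vertices:
  assumes "k simplex \<sigma>"
  shows "\<not> affine_dependent (vertices \<sigma>)" "finite (vertices \<sigma>)" "convex hull (vertices \<sigma>) = \<sigma>"
    "aff_dim \<sigma> = int (card (vertices \<sigma>)) - 1"
proof -
  obtain C where C: "\<not> affine_dependent C" "\<sigma> = convex hull C" using assms by (auto simp: simplex_def)
  then have "vertices \<sigma> = C" by (simp add: vertices_convex_hull)
  then show "\<not> affine_dependent (vertices \<sigma>)" "finite (vertices \<sigma>)" "convex hull (vertices \<sigma>) = \<sigma>"
    "aff_dim \<sigma> = int (card (vertices \<sigma>)) - 1"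
    using C by (auto simp: aff_independent_finite aff_dim_convex_hull aff_dim_affine_independent)
qed

lemma vertices_face_subset: "\<sigma> face_of \<tau> \<Longrightarrow> vertices \<sigma> \<subseteq> vertices \<tau>"
  by (auto simp: vertices_def extreme_point_of_face)

lemma vertices_subset: "vertices \<sigma> \<subseteq> \<sigma>"
  by (auto simp: vertices_def extreme_point_of_def)

lemma aff_dim_lt_imp_negligible:
  fixes S :: "'a::euclidean_space set"
  assumes "aff_dim S < DIM('a)"
  shows "negligible S"
proof -
  obtain a b where "a \<noteq> 0" "S \<subseteq> {x. a \<bullet> x = b}"
    using aff_lowdim_subset_hyperplane[OF assms] by metis
  then show ?thesis using negligible_hyperplane negligible_subset by blast
qed

text \<open>What the argument uses of a primitive triangulation: its full-dimensional simplices are unimodular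
  and every simplex is a face of one of them.\<close>
locale unimodular_complex =
  fixes K :: "(real ^ 'm) set set" and P :: "(real ^ 'm) set"
  assumes K_complex: "simplicial_complex K" and K_union: "\<Union>K = P"
    and P_polytope: "polytope P" and dim_ge_2: "2 \<le> CARD('m)"
    and pure: "\<sigma> \<in> K \<Longrightarrow> \<exists>\<tau>\<in>K. \<sigma> \<subseteq> \<tau> \<and> aff_dim \<tau> = int CARD('m)"
    and top_unimodular: "\<sigma> \<in> K \<Longrightarrow> aff_dim \<sigma> = int CARD('m) \<Longrightarrow> unimodular (vertices \<sigma>)"
begin

lemma finite_K: "finite K"
  using K_complex by (simp add: simplicial_complex_def)

lemma convex_P: "convex P"
  using P_polytope by (rule polytope_imp_convex)

lemma closed_P: "closed P"
  using P_polytope by (rule polytope_imp_closed)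

lemma K_simplex:
  assumes "\<sigma> \<in> K"
  shows "\<not> affine_dependent (vertices \<sigma>)" "finite (vertices \<sigma>)" "convex hull (vertices \<sigma>) = \<sigma>"
    "aff_dim \<sigma> = int (card (vertices \<sigma>)) - 1" "convex \<sigma>" "closed \<sigma>"
proof -
  obtain k where k: "k simplex \<sigma>" using K_complex assms by (auto simp: simplicial_complex_def)
  show "\<not> affine_dependent (vertices \<sigma>)" "finite (vertices \<sigma>)" "convex hull (vertices \<sigma>) = \<sigma>"
    "aff_dim \<sigma> = int (card (vertices \<sigma>)) - 1" "convex \<sigma>" "closed \<sigma>"
    by (fact simplex_vertices[OF k] convex_simplex[OF k] closed_simplex[OF k])+
qed

lemma face_in_K: "\<sigma> \<in> K \<Longrightarrow> F face_of \<sigma> \<Longrightarrow> F \<in> K"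
  using K_complex by (auto simp: simplicial_complex_def)

lemma Int_face: "\<sigma> \<in> K \<Longrightarrow> \<tau> \<in> K \<Longrightarrow> \<sigma> \<inter> \<tau> face_of \<sigma>"
  using K_complex by (auto simp: simplicial_complex_def)

lemma face_iff_subset: "\<sigma> \<in> K \<Longrightarrow> \<tau> \<in> K \<Longrightarrow> \<sigma> face_of \<tau> \<longleftrightarrow> \<sigma> \<subseteq> \<tau>"
  using Int_face[of \<tau> \<sigma>] face_of_imp_subset by (auto simp: Int_absorb1)

lemma subset_iff_vertices: "\<sigma> \<in> K \<Longrightarrow> \<tau> \<in> K \<Longrightarrow> \<sigma> \<subseteq> \<tau> \<longleftrightarrow> vertices \<sigma> \<subseteq> vertices \<tau>"
  by (metis K_simplex(3) face_iff_subset hull_mono vertices_face_subset)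

lemma vertices_inject: "\<sigma> \<in> K \<Longrightarrow> \<tau> \<in> K \<Longrightarrow> vertices \<sigma> = vertices \<tau> \<Longrightarrow> \<sigma> = \<tau>"
  by (metis K_simplex(3))

lemma hull_subset_vertices:
  assumes "\<tau> \<in> K" "C \<subseteq> vertices \<tau>"
  shows "convex hull C \<in> K" "vertices (convex hull C) = C"
proof -
  have "convex hull C face_of convex hull (vertices \<tau>)"
    using face_of_convex_hull_affine_independent[OF K_simplex(1)[OF assms(1)]] assms(2) by blast
  then show "convex hull C \<in> K" using face_in_K K_simplex(3) assms(1) by simp
  show "vertices (convex hull C) = C"
    using affine_dependent_subset assms K_simplex(1) by (intro vertices_convex_hull) blast
qed

lemma vertex_mem_iff: "\<sigma> \<in> K \<Longrightarrow> \<tau> \<in> K \<Longrightarrow> \<sigma> \<subseteq> \<tau> \<Longrightarrow> v \<in> vertices \<tau> \<Longrightarrow> v \<in> \<sigma> \<longleftrightarrow> v \<in> vertices \<sigma>"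
  using face_iff_subset[of \<sigma> \<tau>] by (auto simp: vertices_def extreme_point_of_face)

lemma card_vertices_le: "\<sigma> \<in> K \<Longrightarrow> card (vertices \<sigma>) \<le> Suc CARD('m)"
  using K_simplex(4)[of \<sigma>] aff_dim_le_DIM[of \<sigma>] by auto

lemma vertices_lat_M: "\<sigma> \<in> K \<Longrightarrow> vertices \<sigma> \<subseteq> lat_M"
  using pure[of \<sigma>] top_unimodular subset_iff_vertices unfolding unimodular_def by blast

text \<open>The intersection is a face of \<open>\<sigma>\<close> that meets the relative interior of \<open>\<sigma>\<close>.\<close>
lemma carrier_subset:
  assumes "\<sigma> \<in> K" "\<tau> \<in> K" "x \<in> rel_interior \<sigma>" "x \<in> \<tau>"
  shows "\<sigma> \<subseteq> \<tau>"
  using subset_of_face_of[OF Int_face[OF assms(1,2)], of \<sigma>] assms rel_interior_subset by blast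

text \<open>Some point \<open>p\<close> of \<open>\<sigma>\<close> is interior to \<open>P\<close>.  The segment from \<open>p\<close> to a relatively interior point \<open>x\<close> can be
  prolonged within \<open>\<sigma>\<close>, so \<open>x\<close> lies strictly between \<open>p\<close> and another point of \<open>P\<close>.\<close>
lemma rel_interior_subset_interior:
  assumes "\<sigma> \<in> K" "\<not> \<sigma> \<subseteq> frontier P"
  shows "rel_interior \<sigma> \<subseteq> interior P"
proof
  fix x assume x: "x \<in> rel_interior \<sigma>"
  have \<sigma>P: "\<sigma> \<subseteq> P" using K_union assms(1) by blast
  then obtain p where p: "p \<in> \<sigma>" "p \<in> interior P"
    using assms(2) closed_P closure_closed[of P] by (auto simp: frontier_def)
  show "x \<in> interior P"
  proof (cases "x = p")
    case False
    obtain e where e: "e > 1" "(1 - e) *\<^sub>R p + e *\<^sub>R x \<in> \<sigma>"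
      using convex_rel_interior_iff[OF K_simplex(5)[OF assms(1)]] p(1) x by blast
    define y where "y = (1 - e) *\<^sub>R p + e *\<^sub>R x"
    have "y \<in> closure P" using e \<sigma>P closure_subset y_def by blast
    moreover have "x = (1 - 1 / e) *\<^sub>R p + (1 / e) *\<^sub>R y"
      using e(1) by (simp add: y_def algebra_simps diff_divide_distrib)
    moreover have "p \<noteq> y"
    proof
      assume "p = y"
      then have "e *\<^sub>R (x - p) = 0" by (auto simp: y_def algebra_simps)
      then show False using False e(1) by auto
    qed
    ultimately have "x \<in> open_segment p y" using e(1) by (auto simp: in_segment intro!: exI[of _ "1 / e"])
    then show ?thesis
      using in_interior_closure_convex_segment[OF convex_P p(2) \<open>y \<in> closure P\<close>] by blast
  qed (use p in simp)
qed

text \<open>Two simplices on the same side of their common facet overlap.  In the affine coordinates of the first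
  simplex, \<open>v2\<close> has a positive coefficient at \<open>v1\<close>; hence a point slightly off the barycentre of \<open>S\<close> in
  the direction of \<open>v2\<close> has positive coordinates throughout and lies in the relative interior of the
  first simplex, but also in the second.\<close>
lemma apex_unique_on_side:
  assumes \<tau>1: "convex hull (insert v1 S) \<in> K" "vertices (convex hull (insert v1 S)) = insert v1 S"
    and \<tau>2: "convex hull (insert v2 S) \<in> K" "vertices (convex hull (insert v2 S)) = insert v2 S"
    and v: "v1 \<notin> S" "v2 \<notin> S" and full: "affine hull (insert v1 S) = UNIV"
    and S: "\<And>w. w \<in> S \<Longrightarrow> a \<bullet> w = b" "S \<noteq> {}" and side: "a \<bullet> v1 > b" "a \<bullet> v2 > b"
  shows "v1 = v2"
proof -
  have indep: "\<not> affine_dependent (insert v1 S)" using K_simplex(1)[OF \<tau>1(1)] \<tau>1(2) by simp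
  have finS: "finite S" using K_simplex(2)[OF \<tau>1(1)] \<tau>1(2) by simp
  have "finite (insert v1 S)" using finS by simp
  from affine_hull_finite[OF this] full
  obtain c where c: "sum c (insert v1 S) = 1" "(\<Sum>w\<in>insert v1 S. c w *\<^sub>R w) = v2" by blast
  have c': "c v1 + sum c S = 1" using c(1) finS v by simp
  have "c v1 * (a \<bullet> v1 - b) = a \<bullet> v2 - b"
  proof -
    have "a \<bullet> v2 = c v1 * (a \<bullet> v1) + (\<Sum>w\<in>S. c w * (a \<bullet> w))"
      using finS v by (simp add: inner_add_right inner_sum_right flip: c(2))
    also have "(\<Sum>w\<in>S. c w * (a \<bullet> w)) = sum c S * b"
      by (simp add: S(1) sum_distrib_right)
    finally show ?thesis using c' by (simp add: algebra_simps flip: distrib_right) (metis add.commute distrib_left mult.right_neutral)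
  qed
  then have "c v1 * (a \<bullet> v1 - b) > 0" using side by simp
  then have c1: "c v1 > 0" using side(1) by (simp add: zero_less_mult_iff)
  define u where "u = (1 / real (card S))"
  have u: "u > 0" using finS S(2) by (simp add: u_def card_gt_0_iff)
  have sumu: "(\<Sum>w\<in>S. u) = 1" using finS S(2) by (simp add: u_def)
  have "\<forall>\<^sub>F e in at_right 0. 0 < (1 - e) * u + e * c w" for w
  proof -
    have "((\<lambda>e. (1 - e) * u + e * c w) \<longlongrightarrow> (1 - 0) * u + 0 * c w) (at_right 0)"
      by (intro tendsto_intros)
    then show ?thesis using u by (intro order_tendstoD(1)[where a = 0]) auto
  qed
  then have "\<forall>\<^sub>F e in at_right 0. \<forall>w\<in>S. 0 < (1 - e) * u + e * c w"
    using finS by (intro eventually_ball_finite) auto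
  moreover have "\<forall>\<^sub>F e in at_right (0::real). 0 < e \<and> e < 1"
    by (auto simp: eventually_at_right_field intro!: exI[of _ 1])
  ultimately have "\<forall>\<^sub>F e in at_right 0. (\<forall>w\<in>S. 0 < (1 - e) * u + e * c w) \<and> 0 < e \<and> e < 1"
    by (rule eventually_conj)
  then obtain e :: real where e: "\<And>w. w \<in> S \<Longrightarrow> 0 < (1 - e) * u + e * c w" "0 < e" "e < 1"
    using eventually_happens by fastforce
  define x where "x = (\<Sum>w\<in>S. u *\<^sub>R w)"
  define y where "y = (1 - e) *\<^sub>R x + e *\<^sub>R v2"
  have "x \<in> convex hull S"
    unfolding x_def convex_hull_finite[OF finS] using u sumu by (auto intro!: exI[of _ "\<lambda>_. u"])
  then have "x \<in> convex hull (insert v2 S)" using hull_mono[of S "insert v2 S" convex] by blast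
  moreover have "v2 \<in> convex hull (insert v2 S)" by (simp add: hull_inc)
  ultimately have y2: "y \<in> convex hull (insert v2 S)"
    unfolding y_def using e convexD_alt[OF convex_convex_hull, of x "insert v2 S" v2 e] by simp
  define t where "t w = (if w = v1 then e * c v1 else (1 - e) * u + e * c w)" for w
  have tS: "t w = (1 - e) * u + e * c w" if "w \<in> S" for w using that v by (auto simp: t_def)
  have "y \<in> rel_interior (convex hull (insert v1 S))"
    unfolding rel_interior_convex_hull_explicit[OF indep]
  proof (intro CollectI exI[of _ t] conjI ballI)
    show "0 < t w" if "w \<in> insert v1 S" for w using that e c1 by (auto simp: t_def)
    have "sum t S = (\<Sum>w\<in>S. (1 - e) * u) + (\<Sum>w\<in>S. e * c w)" by (simp add: tS sum.distrib)
    also have "\<dots> = (1 - e) + e * sum c S" by (simp only: sum_distrib_left[symmetric] sumu mult_1_right)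
    finally have "sum t S = (1 - e) + e * sum c S" .
    moreover have "sum t (insert v1 S) = e * c v1 + sum t S" using finS v by (simp add: t_def)
    ultimately have "sum t (insert v1 S) = (1 - e) + e * (c v1 + sum c S)"
      by (simp add: algebra_simps)
    then show "sum t (insert v1 S) = 1" using c' by simp
    have "(\<Sum>w\<in>S. t w *\<^sub>R w) = (1 - e) *\<^sub>R x + e *\<^sub>R (\<Sum>w\<in>S. c w *\<^sub>R w)"
      by (simp add: tS x_def scaleR_add_left sum.distrib scaleR_sum_right)
    moreover have "v2 = c v1 *\<^sub>R v1 + (\<Sum>w\<in>S. c w *\<^sub>R w)" using c(2) finS v by simp
    ultimately show "(\<Sum>w\<in>insert v1 S. t w *\<^sub>R w) = y"
      using finS v by (simp add: t_def[of v1] y_def scaleR_add_right)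
  qed
  then have "convex hull (insert v1 S) \<subseteq> convex hull (insert v2 S)"
    using carrier_subset \<tau>1(1) \<tau>2(1) y2 by blast
  then have "insert v1 S \<subseteq> insert v2 S"
    using subset_iff_vertices[OF \<tau>1(1) \<tau>2(1)] \<tau>1(2) \<tau>2(2) by simp
  then show ?thesis using v by blast
qed

text \<open>A small enough neighbourhood of \<open>x\<close> lies in \<open>P\<close> and only meets simplices that contain \<open>x\<close>, hence \<open>\<sigma>\<close>.
  A simplex that contains a point on the required side is thus \<open>\<sigma>\<close> with one more vertex on this side.\<close>
lemma apex_exists_on_side:
  assumes \<sigma>: "\<sigma> \<in> K" "aff_dim \<sigma> = int CARD('m) - 1" and x: "x \<in> rel_interior \<sigma>" "x \<in> interior P"
    and hyp: "\<And>y. y \<in> \<sigma> \<Longrightarrow> a \<bullet> y = b" and "a \<noteq> 0"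
  shows "\<exists>v. v \<notin> vertices \<sigma> \<and> convex hull (insert v (vertices \<sigma>)) \<in> K
    \<and> vertices (convex hull (insert v (vertices \<sigma>))) = insert v (vertices \<sigma>) \<and> a \<bullet> v > b"
proof -
  define U where "U = interior P - \<Union>{\<tau>\<in>K. x \<notin> \<tau>}"
  have "closed (\<Union>{\<tau>\<in>K. x \<notin> \<tau>})" using finite_K K_simplex(6) by (intro closed_Union) auto
  then have "open U" "x \<in> U" using x(2) by (auto simp: U_def)
  then obtain r where r: "r > 0" "ball x r \<subseteq> U" by (meson openE)
  define t where "t = r / (2 * norm a)"
  have t: "t > 0" using r(1) \<open>a \<noteq> 0\<close> by (simp add: t_def)
  define y where "y = x + t *\<^sub>R a"
  have "dist x y = r / 2" using r(1) \<open>a \<noteq> 0\<close> by (simp add: y_def t_def dist_norm)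
  then have yU: "y \<in> U" using r by auto
  have x\<sigma>: "x \<in> \<sigma>" using x(1) rel_interior_subset by blast
  have ay: "a \<bullet> y > b" using hyp[OF x\<sigma>] t \<open>a \<noteq> 0\<close> by (simp add: y_def inner_add_right)
  have "y \<in> P" using yU interior_subset by (auto simp: U_def)
  then obtain \<tau> where \<tau>: "\<tau> \<in> K" "y \<in> \<tau>" using K_union by blast
  then have "x \<in> \<tau>" using yU by (auto simp: U_def)
  then have "\<sigma> \<subseteq> \<tau>" using carrier_subset[OF \<sigma>(1) \<tau>(1) x(1)] by blast
  then have sub: "vertices \<sigma> \<subseteq> vertices \<tau>" using subset_iff_vertices \<sigma>(1) \<tau>(1) by simp
  have "y \<notin> \<sigma>" using hyp ay by fastforce
  then have "vertices \<sigma> \<noteq> vertices \<tau>" using vertices_inject[OF \<sigma>(1) \<tau>(1)] \<tau>(2) by blast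
  then obtain v where v: "v \<in> vertices \<tau>" "v \<notin> vertices \<sigma>" using sub by blast
  have "card (vertices \<sigma>) = CARD('m)" using K_simplex(4)[OF \<sigma>(1)] \<sigma>(2) by simp
  then have "card (insert v (vertices \<sigma>)) = Suc CARD('m)" using v K_simplex(2)[OF \<sigma>(1)] by simp
  then have eq: "vertices \<tau> = insert v (vertices \<sigma>)"
    using card_seteq[of "vertices \<tau>" "insert v (vertices \<sigma>)"] card_vertices_le[OF \<tau>(1)] sub v
      K_simplex(2)[OF \<tau>(1)] by auto
  then have hull: "convex hull (insert v (vertices \<sigma>)) = \<tau>" using K_simplex(3)[OF \<tau>(1)] by simp
  have "a \<bullet> v > b"
  proof (rule ccontr)
    assume "\<not> a \<bullet> v > b"
    then have "insert v (vertices \<sigma>) \<subseteq> {z. a \<bullet> z \<le> b}" using hyp vertices_subset by fastforce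
    then have "\<tau> \<subseteq> {z. a \<bullet> z \<le> b}"
      using hull_minimal[of _ "{z. a \<bullet> z \<le> b}" convex] convex_halfspace_le hull by metis
    then show False using \<tau>(2) ay by auto
  qed
  then show ?thesis using v \<tau>(1) hull eq by auto
qed

text \<open>There is one on each side of the hyperplane that \<open>\<sigma>\<close> spans.\<close>
lemma two_cofacets:
  assumes \<sigma>: "\<sigma> \<in> K" "aff_dim \<sigma> = int CARD('m) - 1" "\<not> \<sigma> \<subseteq> frontier P"
  obtains v1 v2 where "v1 \<noteq> v2" "v1 \<notin> vertices \<sigma>" "v2 \<notin> vertices \<sigma>"
    "{\<tau>\<in>K. aff_dim \<tau> = int CARD('m) \<and> \<sigma> \<subseteq> \<tau>}
      = {convex hull (insert v1 (vertices \<sigma>)), convex hull (insert v2 (vertices \<sigma>))}"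
    "vertices (convex hull (insert v1 (vertices \<sigma>))) = insert v1 (vertices \<sigma>)"
    "vertices (convex hull (insert v2 (vertices \<sigma>))) = insert v2 (vertices \<sigma>)"
proof -
  define S where "S = vertices \<sigma>"
  have S: "finite S" "convex hull S = \<sigma>" "card S = CARD('m)" "S \<noteq> {}"
    using K_simplex[OF \<sigma>(1)] \<sigma>(2) by (auto simp: S_def)
  have "aff_dim \<sigma> = DIM(real ^ 'm) - 1" using \<sigma>(2) by simp
  then obtain a b where ab: "a \<noteq> 0" "affine hull \<sigma> = {x. a \<bullet> x = b}"
    unfolding aff_dim_eq_hyperplane by blast
  have hyp: "a \<bullet> y = b" if "y \<in> \<sigma>" for y using that ab(2) hull_inc[of y \<sigma>] by blast
  have "\<sigma> \<noteq> {}" using S by auto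
  then obtain x where x: "x \<in> rel_interior \<sigma>" using rel_interior_eq_empty K_simplex(5)[OF \<sigma>(1)] by blast
  then have xP: "x \<in> interior P" using rel_interior_subset_interior[OF \<sigma>(1,3)] by blast
  obtain v1 where v1: "v1 \<notin> S" "convex hull (insert v1 S) \<in> K"
      "vertices (convex hull (insert v1 S)) = insert v1 S" "a \<bullet> v1 > b"
    using apex_exists_on_side[OF \<sigma>(1,2) x xP hyp ab(1)] by (auto simp: S_def)
  obtain v2 where v2: "v2 \<notin> S" "convex hull (insert v2 S) \<in> K"
      "vertices (convex hull (insert v2 S)) = insert v2 S" "a \<bullet> v2 < b"
    using apex_exists_on_side[OF \<sigma>(1,2) x xP, of "- a" "- b"] hyp ab(1) by (auto simp: S_def)
  have dim: "aff_dim (convex hull (insert v S)) = int CARD('m)"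
    if "v \<notin> S" "convex hull (insert v S) \<in> K" "vertices (convex hull (insert v S)) = insert v S" for v
    using K_simplex(4)[OF that(2)] that(1,3) S by simp
  have full: "affine hull (insert v S) = UNIV"
    if "v \<notin> S" "convex hull (insert v S) \<in> K" "vertices (convex hull (insert v S)) = insert v S" for v
    using dim[OF that] aff_dim_eq_full[of "insert v S"] by (simp add: aff_dim_convex_hull)
  have "{\<tau>\<in>K. aff_dim \<tau> = int CARD('m) \<and> \<sigma> \<subseteq> \<tau>} = {convex hull (insert v1 S), convex hull (insert v2 S)}"
  proof (intro equalityI subsetI)
    fix \<tau> assume "\<tau> \<in> {convex hull (insert v1 S), convex hull (insert v2 S)}"
    then show "\<tau> \<in> {\<tau>\<in>K. aff_dim \<tau> = int CARD('m) \<and> \<sigma> \<subseteq> \<tau>}"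
      using v1 v2 dim S(2) hull_mono[of S "insert v1 S" convex] hull_mono[of S "insert v2 S" convex]
      by auto
  next
    fix \<tau> assume "\<tau> \<in> {\<tau>\<in>K. aff_dim \<tau> = int CARD('m) \<and> \<sigma> \<subseteq> \<tau>}"
    then have \<tau>: "\<tau> \<in> K" "aff_dim \<tau> = int CARD('m)" "\<sigma> \<subseteq> \<tau>" by auto
    have sub: "S \<subseteq> vertices \<tau>" using subset_iff_vertices[OF \<sigma>(1) \<tau>(1)] \<tau>(3) by (simp add: S_def)
    have "card (vertices \<tau>) = Suc CARD('m)" using K_simplex(4)[OF \<tau>(1)] \<tau>(2) by simp
    then have "card (vertices \<tau> - S) = 1" using sub S card_Diff_subset[OF S(1) sub] by simp
    then obtain v where "vertices \<tau> - S = {v}" by (auto simp: card_1_singleton_iff)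
    then have v: "v \<notin> S" "vertices \<tau> = insert v S" using sub by auto
    then have hull: "convex hull (insert v S) = \<tau>" using K_simplex(3)[OF \<tau>(1)] by simp
    note v' = v(1) \<tau>(1)[folded hull] v(2)[folded hull]
    have "a \<bullet> v \<noteq> b"
    proof
      assume "a \<bullet> v = b"
      then have "insert v S \<subseteq> {x. a \<bullet> x = b}" using hyp S_def vertices_subset by blast
      then have "affine hull (insert v S) \<subseteq> {x. a \<bullet> x = b}"
        using affine_hyperplane by (rule hull_minimal)
      then have "a \<bullet> v1 = b" using full[OF v'] by blast
      then show False using v1(4) by simp
    qed
    then consider "a \<bullet> v > b" | "a \<bullet> v < b" by linarith
    then have "v = v1 \<or> v = v2"
    proof cases
      case 1
      then have "v = v1"
        using apex_unique_on_side[OF v'(2,3) v1(2,3) v(1) v1(1) full[OF v'], of a b] hyp S(4) v1(4)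
          vertices_subset S_def by blast
      then show ?thesis ..
    next
      case 2
      then have "v = v2"
        using apex_unique_on_side[OF v'(2,3) v2(2,3) v(1) v2(1) full[OF v'], of "- a" "- b"] hyp S(4) v2(4)
          vertices_subset S_def by auto
      then show ?thesis ..
    qed
    then show "\<tau> \<in> {convex hull (insert v1 S), convex hull (insert v2 S)}" using hull by auto
  qed
  moreover have "v1 \<noteq> v2" using v1(4) v2(4) by auto
  ultimately show thesis using that[of v1 v2] v1 v2 by (simp add: S_def)
qed

text \<open>A simplex in between is obtained by adding to \<open>\<sigma>\<close> one of the two remaining vertices of \<open>\<tau>\<close>.\<close>
lemma two_intermediate_simplices:
  assumes "\<sigma> \<in> K" "\<tau> \<in> K" "\<sigma> \<subseteq> \<tau>" "aff_dim \<tau> = aff_dim \<sigma> + 2"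
  shows "card {\<upsilon>\<in>K. \<sigma> \<subseteq> \<upsilon> \<and> \<upsilon> \<subseteq> \<tau> \<and> aff_dim \<upsilon> = aff_dim \<sigma> + 1} = 2"
proof -
  have sub: "vertices \<sigma> \<subseteq> vertices \<tau>" using subset_iff_vertices assms by blast
  have fin: "finite (vertices \<sigma>)" using K_simplex(2) assms by blast
  have "card (vertices \<tau> - vertices \<sigma>) = 2"
    using card_Diff_subset[OF fin sub] K_simplex(4)[OF assms(1)] K_simplex(4)[OF assms(2)] assms(4) by simp
  moreover have "bij_betw (\<lambda>p. convex hull (insert p (vertices \<sigma>))) (vertices \<tau> - vertices \<sigma>)
    {\<upsilon>\<in>K. \<sigma> \<subseteq> \<upsilon> \<and> \<upsilon> \<subseteq> \<tau> \<and> aff_dim \<upsilon> = aff_dim \<sigma> + 1}"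
  proof (rule bij_betw_imageI)
    have hull: "convex hull (insert p (vertices \<sigma>)) \<in> K"
      "vertices (convex hull (insert p (vertices \<sigma>))) = insert p (vertices \<sigma>)"
      if "p \<in> vertices \<tau> - vertices \<sigma>" for p
      using hull_subset_vertices[OF assms(2), of "insert p (vertices \<sigma>)"] that sub by auto
    show "inj_on (\<lambda>p. convex hull (insert p (vertices \<sigma>))) (vertices \<tau> - vertices \<sigma>)"
    proof (rule inj_onI)
      fix p q assume pq: "p \<in> vertices \<tau> - vertices \<sigma>" "q \<in> vertices \<tau> - vertices \<sigma>"
        "convex hull (insert p (vertices \<sigma>)) = convex hull (insert q (vertices \<sigma>))"
      then have "insert p (vertices \<sigma>) = insert q (vertices \<sigma>)" using hull(2) by metis
      then show "p = q" using pq by blast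
    qed
    show "(\<lambda>p. convex hull (insert p (vertices \<sigma>))) ` (vertices \<tau> - vertices \<sigma>)
      = {\<upsilon>\<in>K. \<sigma> \<subseteq> \<upsilon> \<and> \<upsilon> \<subseteq> \<tau> \<and> aff_dim \<upsilon> = aff_dim \<sigma> + 1}"
    proof (intro equalityI subsetI)
      fix \<upsilon> assume "\<upsilon> \<in> (\<lambda>p. convex hull (insert p (vertices \<sigma>))) ` (vertices \<tau> - vertices \<sigma>)"
      then obtain p where p: "p \<in> vertices \<tau> - vertices \<sigma>" "\<upsilon> = convex hull (insert p (vertices \<sigma>))" by blast
      with hull[OF p(1)] have \<upsilon>: "\<upsilon> \<in> K" "vertices \<upsilon> = insert p (vertices \<sigma>)" by simp_all
      then show "\<upsilon> \<in> {\<upsilon>\<in>K. \<sigma> \<subseteq> \<upsilon> \<and> \<upsilon> \<subseteq> \<tau> \<and> aff_dim \<upsilon> = aff_dim \<sigma> + 1}"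
        using p(1) sub fin K_simplex(4)[OF \<upsilon>(1)] K_simplex(4)[OF assms(1)] subset_iff_vertices assms(1,2)
        by auto
    next
      fix \<upsilon> assume "\<upsilon> \<in> {\<upsilon>\<in>K. \<sigma> \<subseteq> \<upsilon> \<and> \<upsilon> \<subseteq> \<tau> \<and> aff_dim \<upsilon> = aff_dim \<sigma> + 1}"
      then have \<upsilon>: "\<upsilon> \<in> K" "vertices \<sigma> \<subseteq> vertices \<upsilon>" "vertices \<upsilon> \<subseteq> vertices \<tau>" "aff_dim \<upsilon> = aff_dim \<sigma> + 1"
        using subset_iff_vertices assms(1,2) by auto
      have "card (vertices \<upsilon> - vertices \<sigma>) = 1"
        using card_Diff_subset[OF fin \<upsilon>(2)] K_simplex(4)[OF assms(1)] K_simplex(4)[OF \<upsilon>(1)] \<upsilon>(4) by simp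
      then obtain p where "vertices \<upsilon> - vertices \<sigma> = {p}" by (auto simp: card_1_singleton_iff)
      then have p: "p \<in> vertices \<tau> - vertices \<sigma>" "vertices \<upsilon> = insert p (vertices \<sigma>)" using \<upsilon> by auto
      then show "\<upsilon> \<in> (\<lambda>p. convex hull (insert p (vertices \<sigma>))) ` (vertices \<tau> - vertices \<sigma>)"
        using K_simplex(3)[OF \<upsilon>(1)] by (intro image_eqI[of _ _ p]) auto
    qed
  qed
  ultimately show ?thesis using bij_betw_same_card by fastforce
qed

end

text \<open>Maximal simplices have positive volume and are therefore full-dimensional.  Conversely a
  full-dimensional simplex is maximal, since a simplex that contains it has it as a face.\<close>
lemma primitive_triangulation_unimodular_complex:
  fixes P :: "(real ^ 'm) set"
  assumes "primitive_triangulation K P" "polytope P" "2 \<le> CARD('m)"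
  shows "unimodular_complex K P"
proof -
  have K: "simplicial_complex K" "\<Union>K = P" "finite K" "\<And>\<sigma>. \<sigma> \<in> K \<Longrightarrow> vertices \<sigma> \<subseteq> lat_M"
    "\<And>\<sigma>. \<sigma> \<in> K \<Longrightarrow> (\<forall>\<tau>\<in>K. \<sigma> \<subseteq> \<tau> \<longrightarrow> \<tau> = \<sigma>) \<Longrightarrow> measure lebesgue \<sigma> = 1 / fact CARD('m)"
    using assms(1) by (auto simp: primitive_triangulation_def simplicial_complex_def)
  show ?thesis
  proof
    fix \<sigma> assume \<sigma>: "\<sigma> \<in> K"
    obtain \<tau> where \<tau>: "\<tau> \<in> K" "\<sigma> \<subseteq> \<tau>" "\<forall>\<upsilon>\<in>K. \<tau> \<subseteq> \<upsilon> \<longrightarrow> \<upsilon> = \<tau>"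
      using finite_has_maximal2[OF K(3) \<sigma>] by metis
    have "\<not> negligible \<tau>"
      using K(5)[OF \<tau>(1,3)] negligible_imp_measure0[of \<tau>] by auto
    then have "aff_dim \<tau> = int CARD('m)"
      using aff_dim_lt_imp_negligible[of \<tau>] aff_dim_le_DIM[of \<tau>] by fastforce
    then show "\<exists>\<tau>\<in>K. \<sigma> \<subseteq> \<tau> \<and> aff_dim \<tau> = int CARD('m)" using \<tau> by blast
  next
    fix \<sigma> assume \<sigma>: "\<sigma> \<in> K" "aff_dim \<sigma> = int CARD('m)"
    have "\<tau> = \<sigma>" if "\<tau> \<in> K" "\<sigma> \<subseteq> \<tau>" for \<tau>
    proof (rule ccontr)
      assume "\<tau> \<noteq> \<sigma>"
      have "\<tau> \<inter> \<sigma> face_of \<tau>" using K(1) that(1) \<sigma>(1) by (auto simp: simplicial_complex_def)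
      then have "\<sigma> face_of \<tau>" using that(2) by (simp add: Int_absorb1)
      moreover have "convex \<tau>" using K(1) that(1) convex_simplex unfolding simplicial_complex_def by blast
      ultimately have "aff_dim \<sigma> < aff_dim \<tau>" using face_of_aff_dim_lt \<open>\<tau> \<noteq> \<sigma>\<close> by metis
      then show False using \<sigma>(2) aff_dim_le_DIM[of \<tau>] by simp
    qed
    then have vol: "measure lebesgue \<sigma> = 1 / fact CARD('m)" using K(5)[OF \<sigma>(1)] by blast
    obtain k where "k simplex \<sigma>" using K(1) \<sigma>(1) by (auto simp: simplicial_complex_def)
    note V = simplex_vertices[OF this]
    have "affine hull \<sigma> = UNIV" using \<sigma>(2) aff_dim_eq_full[of \<sigma>] by simp
    then have "affine hull (vertices \<sigma>) = UNIV" by (metis V(3) affine_hull_convex_hull)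
    then show "unimodular (vertices \<sigma>)"
      using unimodular_simplex[of "vertices \<sigma>"] V K(4)[OF \<sigma>(1)] vol \<sigma>(2) by (auto simp: unimodular_def)
  qed (use assms K in auto)
qed


section \<open>Cochains on subcomplexes\<close>

lemma sum_const_two:
  assumes "card A = 2" and "\<And>x. x \<in> A \<Longrightarrow> f x = c" and "c + c = (0 :: 'b::comm_monoid_add)"
  shows "sum f A = 0"
proof -
  obtain a b where "A = {a, b}" "a \<noteq> b" using assms(1) by (auto simp: card_2_iff)
  then show ?thesis using assms(2,3) by simp
qed

lemma facets_of_segment:
  assumes "a \<noteq> b"
  shows "{F. F facet_of convex hull {a, b}} = {{a}, {b}}"
proof -
  have diff: "{a, b} - {a} = {b}" "{a, b} - {b} = {a}" using assms by auto
  have "F facet_of convex hull {a, b} \<longleftrightarrow> F \<noteq> {} \<and> (F = convex hull ({a, b} - {a}) \<or> F = convex hull ({a, b} - {b}))" for F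
    unfolding facet_of_convex_hull_affine_independent[OF affine_independent_2] by blast
  then have "F facet_of convex hull {a, b} \<longleftrightarrow> F = {b} \<or> F = {a}" for F
    unfolding diff by auto
  then show ?thesis by blast
qed

definition at_vertex :: "real ^ 'm \<Rightarrow> real ^ 'm \<Rightarrow> bit"
  where "at_vertex v x = of_bool (x = v)"

lemma simp_cobd_chi_segment:
  "a \<noteq> b \<Longrightarrow> simp_cobd (chi v) (convex hull {a, b}) = at_vertex v a + at_vertex v b"
  unfolding simp_cobd_def facets_of_segment by (simp add: chi_def at_vertex_def of_bool_def)

lemma restrict_1cochain_face:
  assumes "\<sigma> face_of \<tau>"
  shows "restrict_1cochain \<sigma> (restrict_1cochain \<tau> c) = restrict_1cochain \<sigma> c"
  unfolding restrict_1cochain_def edge_of_def using face_of_trans[OF _ assms] by (intro ext) auto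

lemma z_map_0 [simp]: "z_map e 0 = 0"
  by (simp add: z_map_def restrict_1cochain_def fun_eq_iff)

lemma trans_map_W1 [simp]: "trans_map sheaf_W1 e' e u = u"
  and trans_map_N2 [simp]: "trans_map sheaf_N2 e' e u = u"
  and trans_map_Z1 [simp]: "trans_map sheaf_Z1 e' e c = restrict_1cochain (fst e) c"
  and stalk_N2 [simp]: "stalk sheaf_N2 e = UNIV"
  and stalk_Z1 [simp]: "stalk sheaf_Z1 (\<sigma>, Q) = simp_Z1 \<sigma>"
  by (simp_all add: sheaf_W1_def sheaf_N2_def sheaf_Z1_def)

lemma zero_in_stalk_W1: "0 \<in> stalk sheaf_W1 e"
  by (cases e) (auto simp: sheaf_W1_def lat_N_eq lat_M_def red2_def vec_eq_iff image_iff intro!: exI[of _ 0])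
definition restrict_cochain :: "'m::finite cell set \<Rightarrow> ('m cell \<Rightarrow> 'v::zero) \<Rightarrow> 'm cell \<Rightarrow> 'v"
  where "restrict_cochain B c = (\<lambda>e. if e \<in> B then c e else 0)"

lemma cobd_restrict_cochain:
  assumes "B \<subseteq> A" and "\<And>e e'. e \<in> B \<Longrightarrow> e' \<in> A \<Longrightarrow> cell_le e' e \<Longrightarrow> e' \<in> B"
  shows "cobd B F (restrict_cochain B c) = restrict_cochain B (cobd A F c)"
proof
  fix e
  show "cobd B F (restrict_cochain B c) e = restrict_cochain B (cobd A F c) e"
  proof (cases "e \<in> B")
    case True
    then have "{e'. e' \<in> B \<and> cell_le e' e \<and> cell_dim e = cell_dim e' + 1}
        = {e'. e' \<in> A \<and> cell_le e' e \<and> cell_dim e = cell_dim e' + 1}"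
      using assms by blast
    then show ?thesis using True assms
      unfolding cobd_def restrict_cochain_def by (auto intro!: sum.cong)
  qed (simp add: cobd_def restrict_cochain_def)
qed

lemma restrict_cochain_cocycle:
  assumes "B \<subseteq> A" and "\<And>e e'. e \<in> B \<Longrightarrow> e' \<in> A \<Longrightarrow> cell_le e' e \<Longrightarrow> e' \<in> B"
    and "c \<in> cocycles A F q"
  shows "restrict_cochain B c \<in> cocycles B F q"
  using assms cobd_restrict_cochain[OF assms(1,2), where F = F and c = c]
  by (auto simp: cocycles_def cochains_def restrict_cochain_def fun_eq_iff split: if_splits)

lemma cochains_stalk:
  "c \<in> cochains A F q \<Longrightarrow> e \<in> A \<Longrightarrow> cell_dim e = int q \<Longrightarrow> c e \<in> stalk F e"
  unfolding cochains_def mem_Collect_eq by (drule spec[of _ e]) simp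

lemma cochains_zero:
  "c \<in> cochains A F q \<Longrightarrow> e \<notin> A \<or> cell_dim e \<noteq> int q \<Longrightarrow> c e = 0"
  unfolding cochains_def mem_Collect_eq by (drule spec[of _ e]) auto

definition cell_facets :: "'m::finite cell set \<Rightarrow> 'm cell \<Rightarrow> 'm cell set"
  where "cell_facets A e = {e'. e' \<in> A \<and> cell_le e' e \<and> cell_dim e = cell_dim e' + 1}"

lemma cobd_N2: "e \<in> A \<Longrightarrow> cobd A sheaf_N2 c e = sum c (cell_facets A e)"
  and cobd_W1: "e \<in> A \<Longrightarrow> cobd A sheaf_W1 c e = sum c (cell_facets A e)"
  by (simp_all add: cobd_def cell_facets_def)

text \<open>Without nonzero coboundaries a cohomology class is a single cocycle.  On elements that are not
  cocycles the relation is empty.\<close>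
lemma cohomologous_class_trivial:
  assumes "coboundaries A F q = {0}"
  shows "cohomologous A F q `` {c} = (if c \<in> cocycles A F q then {c} else {})"
  using assms by (auto simp: cohomologous_def)


section \<open>The cells around an interior vertex\<close>

context unimodular_complex
begin

lemma mem_X: "(\<sigma>, Q) \<in> cpx_X K P \<longleftrightarrow> \<sigma> \<in> K \<and> 1 \<le> aff_dim \<sigma> \<and> Q face_of P \<and> \<sigma> \<subseteq> Q"
  by (auto simp: cpx_X_def cpx_Y_def)

lemma finite_X: "finite (cpx_X K P)"
proof (rule finite_subset)
  show "cpx_X K P \<subseteq> K \<times> {Q. Q face_of P}" by (auto simp: mem_X)
  show "finite (K \<times> {Q. Q face_of P})"
    using finite_K finite_polytope_faces[OF P_polytope] by simp
qed

lemma aff_dim_P: "\<sigma> \<in> K \<Longrightarrow> aff_dim P = int CARD('m)"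
proof -
  assume "\<sigma> \<in> K"
  then obtain \<tau> where \<tau>: "\<tau> \<in> K" "aff_dim \<tau> = int CARD('m)" using pure by blast
  then have "\<tau> \<subseteq> P" using K_union by blast
  then show ?thesis using aff_dim_subset[of \<tau> P] aff_dim_le_DIM[of P] \<tau>(2) by simp
qed

lemma cell_dim_P: "\<sigma> \<in> K \<Longrightarrow> cell_dim (\<sigma>, P) = int CARD('m) - aff_dim \<sigma>"
  by (simp add: cell_dim_def aff_dim_P)

lemma subset_P: "\<sigma> \<in> K \<Longrightarrow> \<sigma> \<subseteq> P"
  using K_union by blast

lemma interior_vertexD:
  assumes "v \<in> interior_vertices K P"
  shows "{v} \<in> K" "v \<in> interior P"
proof -
  have v: "{v} \<in> K" "v \<notin> frontier P"
    using assms by (auto simp: interior_vertices_def interior_simplices_def)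
  then show "{v} \<in> K" "v \<in> interior P"
    using subset_P closed_P by (auto simp: frontier_def)
qed

lemma mem_vertices_iff: "{v} \<in> K \<Longrightarrow> \<sigma> \<in> K \<Longrightarrow> v \<in> vertices \<sigma> \<longleftrightarrow> v \<in> \<sigma>"
  using face_iff_subset[of "{v}" \<sigma>] by (auto simp: vertices_def face_of_singleton)

lemma face_through_interior_vertex:
  assumes "v \<in> interior_vertices K P" "v \<in> Q" "Q face_of P"
  shows "Q = P"
  using face_of_disjoint_interior[OF assms(3)] interior_vertexD[OF assms(1)] assms(2) by blast

lemma not_frontier:
  assumes "v \<in> interior_vertices K P" "v \<in> \<sigma>"
  shows "\<not> \<sigma> \<subseteq> frontier P"
  using interior_vertexD[OF assms(1)] assms(2) by (auto simp: frontier_def)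

text \<open>The second component of a cell around \<open>v\<close> is a face of \<open>P\<close> through an interior point, so it is \<open>P\<close>.
  Only the cell \<open>[v, P]\<close> itself has a first component of dimension 0.\<close>
lemma mem_dual_boundary:
  assumes "v \<in> interior_vertices K P"
  shows "e \<in> dual_cell_boundary K P {v} \<longleftrightarrow> (\<exists>\<sigma>\<in>K. e = (\<sigma>, P) \<and> v \<in> \<sigma> \<and> 1 \<le> aff_dim \<sigma>)"
proof -
  obtain \<sigma> Q where e: "e = (\<sigma>, Q)" by fastforce
  note vK = interior_vertexD(1)[OF assms]
  have *: "e \<in> dual_cell K P {v} \<longleftrightarrow> \<sigma> \<in> K \<and> v \<in> \<sigma> \<and> Q = P"
  proof
    assume "e \<in> dual_cell K P {v}"
    then have "\<sigma> \<in> K" "{v} face_of \<sigma>" "Q face_of P" "\<sigma> \<subseteq> Q"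
      by (auto simp: dual_cell_def cpx_Y_def cell_le_def e)
    moreover from this have "v \<in> \<sigma>" using face_of_imp_subset by blast
    ultimately show "\<sigma> \<in> K \<and> v \<in> \<sigma> \<and> Q = P" using face_through_interior_vertex[OF assms] by blast
  next
    assume "\<sigma> \<in> K \<and> v \<in> \<sigma> \<and> Q = P"
    then show "e \<in> dual_cell K P {v}"
      using face_iff_subset[OF vK] subset_P face_of_refl[OF convex_P]
      by (auto simp: dual_cell_def cpx_Y_def cell_le_def e)
  qed
  have "\<sigma> = {v} \<longleftrightarrow> \<not> 1 \<le> aff_dim \<sigma>" if \<sigma>: "\<sigma> \<in> K" "v \<in> \<sigma>"
  proof
    assume "\<not> 1 \<le> aff_dim \<sigma>"
    then have "card (vertices \<sigma>) \<le> 1" using K_simplex(4)[OF \<sigma>(1)] by simp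
    moreover have "v \<in> vertices \<sigma>" using mem_vertices_iff[OF vK \<sigma>(1)] \<sigma>(2) by simp
    ultimately have "vertices \<sigma> = {v}"
      using K_simplex(2)[OF \<sigma>(1)] card_seteq[of "vertices \<sigma>" "{v}"] by simp
    then show "\<sigma> = {v}" using K_simplex(3)[OF \<sigma>(1)] by simp
  qed auto
  then show ?thesis unfolding dual_cell_boundary_def using * e by auto
qed

lemma mem_X0:
  "e \<in> cpx_X0 K P \<longleftrightarrow> (\<exists>v\<in>interior_vertices K P. e \<in> dual_cell_boundary K P {v})"
proof -
  have "e \<in> cpx_X K P \<and> e \<in> dual_cell K P {v} \<longleftrightarrow> e \<in> dual_cell_boundary K P {v}"
    if v: "v \<in> interior_vertices K P" for v
  proof
    assume "e \<in> dual_cell_boundary K P {v}"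
    then show "e \<in> cpx_X K P \<and> e \<in> dual_cell K P {v}"
      using mem_dual_boundary[OF v] by (auto simp: dual_cell_boundary_def dual_cell_def cpx_X_def)
  next
    assume "e \<in> cpx_X K P \<and> e \<in> dual_cell K P {v}"
    then show "e \<in> dual_cell_boundary K P {v}"
      by (auto simp: dual_cell_boundary_def cpx_X_def)
  qed
  then show ?thesis unfolding cpx_X0_def by blast
qed

lemma dual_boundary_subset_X0: "v \<in> interior_vertices K P \<Longrightarrow> dual_cell_boundary K P {v} \<subseteq> cpx_X0 K P"
  using mem_X0 by blast

lemma X0_subset_X: "cpx_X0 K P \<subseteq> cpx_X K P"
  by (auto simp: cpx_X0_def)

text \<open>Passing to a face of a cell enlarges the simplex, which keeps containing \<open>v\<close>.\<close>
lemma dual_boundary_closed: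
  assumes v: "v \<in> interior_vertices K P" and e: "e \<in> dual_cell_boundary K P {v}"
    and e': "e' \<in> cpx_X K P" "cell_le e' e"
  shows "e' \<in> dual_cell_boundary K P {v}"
proof -
  obtain \<sigma> Q where [simp]: "e' = (\<sigma>, Q)" by fastforce
  have *: "\<sigma> \<in> K" "1 \<le> aff_dim \<sigma>" "Q face_of P" "\<sigma> \<subseteq> Q" using e'(1) by (auto simp: mem_X)
  moreover have "v \<in> \<sigma>"
    using e e'(2) unfolding mem_dual_boundary[OF v] by (auto simp: cell_le_def dest!: face_of_imp_subset)
  moreover from this have "Q = P" using face_through_interior_vertex[OF v _ *(3)] *(4) by blast
  ultimately show ?thesis unfolding mem_dual_boundary[OF v] by simp
qed

text \<open>That a form in the stalk kills the differences of vertices modulo 2 is clear.  Conversely, \<open>u\<close> is the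
  gradient of a function \<open>f\<close> on the vertices of a full-dimensional simplex, with \<open>f\<close> zero on \<open>\<sigma>\<close>, and
  the integral lift of this gradient vanishes on the tangent space of \<open>\<sigma>\<close>.\<close>
lemma stalk_W1:
  assumes "\<sigma> \<in> K" "\<sigma> \<noteq> {}"
  shows "stalk sheaf_W1 (\<sigma>, Q) = {u. gradient2 (vertices \<sigma>) (\<lambda>x. 0) u}"
proof (intro equalityI subsetI)
  fix u assume "u \<in> stalk sheaf_W1 (\<sigma>, Q)"
  then have "u \<in> red2 ` {U \<in> lat_M. \<forall>t\<in>tangent_space \<sigma>. t \<bullet> U = 0}"
    unfolding sheaf_W1_def lat_N_eq by (simp only: sheaf.simps prod.case)
  then obtain U where U: "U \<in> lat_M" "u = red2 U" "\<And>t. t \<in> tangent_space \<sigma> \<Longrightarrow> t \<bullet> U = 0"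
    by blast
  have "pairing2 (red2 a + red2 b) u = 0" if ab: "a \<in> vertices \<sigma>" "b \<in> vertices \<sigma>" for a b
  proof -
    have lat: "a \<in> lat_M" "b \<in> lat_M" using vertices_lat_M[OF assms(1)] ab by auto
    have "a - b \<in> tangent_space \<sigma>"
      unfolding tangent_space_def using ab vertices_subset by (intro span_base) blast
    then show ?thesis
      using pairing2_red2[OF lat_M_diff[OF lat] U(1)] U(2,3) by (simp add: red2_diff[OF lat])
  qed
  then show "u \<in> {u. gradient2 (vertices \<sigma>) (\<lambda>x. 0) u}" by (simp add: gradient2_def)
next
  fix u assume u: "u \<in> {u. gradient2 (vertices \<sigma>) (\<lambda>x. 0) u}"
  obtain \<tau> where \<tau>: "\<tau> \<in> K" "\<sigma> \<subseteq> \<tau>" "aff_dim \<tau> = int CARD('m)" using pure[OF assms(1)] by blast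
  have "vertices \<sigma> \<noteq> {}" using assms K_simplex(3) by force
  then obtain w where w: "w \<in> vertices \<sigma>" by blast
  define f where "f x = pairing2 (red2 x + red2 w) u" for x
  have um: "unimodular (vertices \<tau>)" using top_unimodular \<tau> by blast
  have fu: "gradient2 (vertices \<tau>) f u"
    by (simp add: gradient2_def f_def pairing2_add_left ac_simps)
  obtain U where U: "U \<in> lat_M" "gradient2 (vertices \<tau>) f (red2 U)"
    "\<And>a b. a \<in> vertices \<tau> \<Longrightarrow> b \<in> vertices \<tau> \<Longrightarrow> f a = f b \<Longrightarrow> (a - b) \<bullet> U = 0"
    using unimodular_gradient2_lift[OF um, of f] by blast
  have "red2 U = u" using unimodular_gradient2_unique[OF um U(2) fu] .
  have sub: "vertices \<sigma> \<subseteq> vertices \<tau>" using subset_iff_vertices assms \<tau> by blast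
  have "f a = 0" if "a \<in> vertices \<sigma>" for a using u that w by (simp add: gradient2_def f_def)
  then have "(x - w) \<bullet> U = 0" if "x \<in> vertices \<sigma>" for x
    using U(3)[of x w] w sub that by auto
  then have "vertices \<sigma> \<subseteq> {x. U \<bullet> x = U \<bullet> w}"
    by (auto simp: inner_diff_left inner_commute[of U])
  then have "\<sigma> \<subseteq> {x. U \<bullet> x = U \<bullet> w}"
    using hull_minimal[of "vertices \<sigma>" _ convex] convex_hyperplane K_simplex(3)[OF assms(1)] by metis
  then have "{x - y | x y. x \<in> \<sigma> \<and> y \<in> \<sigma>} \<subseteq> {t. U \<bullet> t = 0}"
    by (auto simp: inner_diff_right subset_iff)
  then have "tangent_space \<sigma> \<subseteq> {t. U \<bullet> t = 0}"
    unfolding tangent_space_def by (rule span_minimal) (rule subspace_hyperplane)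
  then have "\<forall>t\<in>tangent_space \<sigma>. t \<bullet> U = 0" by (auto simp: inner_commute[of _ U])
  then show "u \<in> stalk sheaf_W1 (\<sigma>, Q)"
    unfolding sheaf_W1_def lat_N_eq using U(1) \<open>red2 U = u\<close> by (simp only: sheaf.simps prod.case) blast
qed

lemma stalk_W1_top:
  assumes "\<tau> \<in> K" "aff_dim \<tau> = int CARD('m)"
  shows "stalk sheaf_W1 (\<tau>, Q) = {0}"
proof -
  have "\<tau> \<noteq> {}" using assms(2) by auto
  then show ?thesis
    using stalk_W1[OF assms(1)] unimodular_kernel_trivial[OF top_unimodular[OF assms]] gradient2_0
    by auto
qed

text \<open>The 0-cells of \<open>X\<^sub>0\<close> belong to full-dimensional simplices, where the sheaf is zero.\<close>
lemma cochains_0_W1: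
  assumes "A \<subseteq> cpx_X0 K P"
  shows "cochains A sheaf_W1 0 = {0}"
proof -
  have "c e = 0" if c: "c \<in> cochains A sheaf_W1 0" for c e
  proof (cases "e \<in> A \<and> cell_dim e = 0")
    case True
    then obtain \<sigma> where \<sigma>: "\<sigma> \<in> K" "e = (\<sigma>, P)" using assms mem_X0 mem_dual_boundary by blast
    then have "aff_dim \<sigma> = int CARD('m)" using True cell_dim_P by simp
    moreover have "c e \<in> stalk sheaf_W1 e" using c True cochains_stalk by (metis of_nat_0)
    ultimately show ?thesis using stalk_W1_top \<sigma> by blast
  qed (use cochains_zero[OF c] in auto)
  then show ?thesis using zero_in_stalk_W1 by (auto simp: cochains_def fun_eq_iff split: if_splits)
qed

lemma coboundaries_1_W1:
  assumes "A \<subseteq> cpx_X0 K P"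
  shows "coboundaries A sheaf_W1 1 = {0}"
proof -
  have "cobd A sheaf_W1 0 = (0 :: 'm cell \<Rightarrow> bit ^ 'm)" by (simp add: cobd_def fun_eq_iff)
  then show ?thesis by (simp add: coboundaries_def cochains_0_W1[OF assms])
qed

definition cofacets :: "(real ^ 'm) set \<Rightarrow> (real ^ 'm) set set"
  where "cofacets \<sigma> = {\<tau>\<in>K. aff_dim \<tau> = aff_dim \<sigma> + 1 \<and> \<sigma> \<subseteq> \<tau>}"

text \<open>In general a face of codimension 1 of \<open>[\<sigma>, Q]\<close> arises by enlarging \<open>\<sigma>\<close> or by shrinking \<open>Q\<close>; the
  second is impossible at an interior vertex.\<close>
lemma cell_facets_at_interior_vertex:
  assumes v: "v \<in> interior_vertices K P" "v \<in> \<sigma>" and \<sigma>: "\<sigma> \<in> K" "1 \<le> aff_dim \<sigma>"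
  shows "cell_facets (cpx_X K P) (\<sigma>, P) = (\<lambda>\<tau>. (\<tau>, P)) ` cofacets \<sigma>"
proof (intro equalityI subsetI)
  fix e assume e: "e \<in> cell_facets (cpx_X K P) (\<sigma>, P)"
  obtain \<tau> Q where [simp]: "e = (\<tau>, Q)" by fastforce
  have *: "\<tau> \<in> K" "Q face_of P" "\<tau> \<subseteq> Q" "\<sigma> face_of \<tau>" "cell_dim (\<sigma>, P) = cell_dim (\<tau>, Q) + 1"
    using e by (auto simp: cell_facets_def mem_X cell_le_def)
  then have "\<sigma> \<subseteq> \<tau>" by (auto dest: face_of_imp_subset)
  then have "Q = P" using face_through_interior_vertex[OF v(1)] v(2) * by blast
  then show "e \<in> (\<lambda>\<tau>. (\<tau>, P)) ` cofacets \<sigma>"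
    using * \<open>\<sigma> \<subseteq> \<tau>\<close> cell_dim_P \<sigma> by (auto simp: cofacets_def)
next
  fix e assume "e \<in> (\<lambda>\<tau>. (\<tau>, P)) ` cofacets \<sigma>"
  then obtain \<tau> where \<tau>: "e = (\<tau>, P)" "\<tau> \<in> K" "aff_dim \<tau> = aff_dim \<sigma> + 1" "\<sigma> \<subseteq> \<tau>"
    by (auto simp: cofacets_def)
  then show "e \<in> cell_facets (cpx_X K P) (\<sigma>, P)"
    using \<sigma> face_iff_subset[OF \<sigma>(1) \<tau>(2)] subset_P face_of_refl[OF convex_P]
    by (auto simp: cell_facets_def mem_X cell_le_def cell_dim_P)
qed

lemma sum_cell_facets:
  assumes "v \<in> interior_vertices K P" "v \<in> \<sigma>" "\<sigma> \<in> K" "1 \<le> aff_dim \<sigma>"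
  shows "sum c (cell_facets (cpx_X K P) (\<sigma>, P)) = (\<Sum>\<tau>\<in>cofacets \<sigma>. c (\<tau>, P))"
  unfolding cell_facets_at_interior_vertex[OF assms] by (subst sum.reindex) (auto simp: inj_on_def)

section \<open>The jump of a gradient across an interior facet\<close>
definition grad :: "(real ^ 'm) set \<Rightarrow> (real ^ 'm \<Rightarrow> bit) \<Rightarrow> bit ^ 'm"
  where "grad \<tau> f = (THE u. gradient2 (vertices \<tau>) f u)"

lemma gradient2_iff_grad:
  assumes "\<tau> \<in> K" "aff_dim \<tau> = int CARD('m)"
  shows "gradient2 (vertices \<tau>) f u \<longleftrightarrow> u = grad \<tau> f"
proof -
  have um: "unimodular (vertices \<tau>)" using top_unimodular assms by blast
  obtain U where "gradient2 (vertices \<tau>) f (red2 U)" using unimodular_gradient2_lift[OF um] by metis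
  then have "\<exists>!u. gradient2 (vertices \<tau>) f u" using unimodular_gradient2_unique[OF um] by blast
  from theI'[OF this] this show ?thesis unfolding grad_def by blast
qed

text \<open>The difference of the gradients of \<open>f\<close> on the two sides of an interior facet \<open>\<sigma>\<close>, as a sum, since
  signs do not matter modulo 2.\<close>
definition jump :: "(real ^ 'm) set \<Rightarrow> (real ^ 'm \<Rightarrow> bit) \<Rightarrow> bit ^ 'm"
  where "jump \<sigma> f = (\<Sum>\<tau>\<in>cofacets \<sigma>. grad \<tau> f)"

lemma interior_facet:
  assumes \<sigma>: "\<sigma> \<in> K" "aff_dim \<sigma> = int CARD('m) - 1" "\<not> \<sigma> \<subseteq> frontier P"
  obtains v1 v2 where "v1 \<noteq> v2" "v1 \<notin> vertices \<sigma>" "v2 \<notin> vertices \<sigma>"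
    "cofacets \<sigma> = {convex hull (insert v1 (vertices \<sigma>)), convex hull (insert v2 (vertices \<sigma>))}"
    "vertices (convex hull (insert v1 (vertices \<sigma>))) = insert v1 (vertices \<sigma>)"
    "vertices (convex hull (insert v2 (vertices \<sigma>))) = insert v2 (vertices \<sigma>)"
    "card (cofacets \<sigma>) = 2"
proof -
  have cof: "cofacets \<sigma> = {\<tau>\<in>K. aff_dim \<tau> = int CARD('m) \<and> \<sigma> \<subseteq> \<tau>}"
    using \<sigma>(2) by (simp add: cofacets_def)
  obtain v1 v2 where v: "v1 \<noteq> v2" "v1 \<notin> vertices \<sigma>" "v2 \<notin> vertices \<sigma>"
    "cofacets \<sigma> = {convex hull (insert v1 (vertices \<sigma>)), convex hull (insert v2 (vertices \<sigma>))}"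
    "vertices (convex hull (insert v1 (vertices \<sigma>))) = insert v1 (vertices \<sigma>)"
    "vertices (convex hull (insert v2 (vertices \<sigma>))) = insert v2 (vertices \<sigma>)"
    unfolding cof by (rule two_cofacets[OF \<sigma>]) 
  then have "convex hull (insert v1 (vertices \<sigma>)) \<noteq> convex hull (insert v2 (vertices \<sigma>))"
    by (metis insertE insertI1)
  then have "card (cofacets \<sigma>) = 2" using v(4) by simp
  then show thesis using that v by blast
qed

text \<open>The jump kills \<open>\<sigma>\<close>.  If it also vanished on \<open>v2 - w\<close> for the apex \<open>v2\<close> and a vertex \<open>w\<close> of \<open>\<sigma>\<close>, it would
  be zero; so jumps are determined by their values on \<open>v2 - w\<close>, which are the values of \<open>\<rho>\<^sub>\<sigma>\<close>.\<close>
lemma jump_eq_iff_rho: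
  assumes \<sigma>: "\<sigma> \<in> K" "aff_dim \<sigma> = int CARD('m) - 1" "\<not> \<sigma> \<subseteq> frontier P"
    and v: "v \<in> vertices \<sigma>" "v' \<in> vertices \<sigma>"
  shows "jump \<sigma> (at_vertex v) = jump \<sigma> (at_vertex v') \<longleftrightarrow> rho_fun K \<sigma> v = rho_fun K \<sigma> v'"
proof -
  define S where "S = vertices \<sigma>"
  obtain v1 v2 where a: "v1 \<noteq> v2" "v1 \<notin> S" "v2 \<notin> S"
    "cofacets \<sigma> = {convex hull (insert v1 S), convex hull (insert v2 S)}"
    "vertices (convex hull (insert v1 S)) = insert v1 S"
    "vertices (convex hull (insert v2 S)) = insert v2 S"
    "card (cofacets \<sigma>) = 2"
    using interior_facet[OF \<sigma>] unfolding S_def by metis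
  define \<tau>1 where "\<tau>1 = convex hull (insert v1 S)"
  define \<tau>2 where "\<tau>2 = convex hull (insert v2 S)"
  have ne: "\<tau>1 \<noteq> \<tau>2" using a(4,7) unfolding \<tau>1_def \<tau>2_def by (auto simp: card_insert_if split: if_splits)
  have \<tau>: "\<tau>1 \<in> K" "aff_dim \<tau>1 = int CARD('m)" "\<sigma> \<subseteq> \<tau>1" "\<tau>2 \<in> K" "aff_dim \<tau>2 = int CARD('m)" "\<sigma> \<subseteq> \<tau>2"
    using a(4) \<sigma>(2) unfolding \<tau>1_def[symmetric] \<tau>2_def[symmetric] by (auto simp: cofacets_def)
  have V: "vertices \<tau>1 = insert v1 S" "vertices \<tau>2 = insert v2 S" using a by (simp_all add: \<tau>1_def \<tau>2_def)
  have um: "unimodular (insert v1 S)" "unimodular (insert v2 S)" using top_unimodular \<tau> V by metis+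
  have S: "finite S" "S \<noteq> {}" using um(1) v(1) by (auto simp: unimodular_def S_def)
  have apices: "apices K \<sigma> = {v1, v2}"
  proof -
    have "\<sigma> facet_of \<tau> \<longleftrightarrow> \<tau> \<in> {\<tau>1, \<tau>2}" if "\<tau> \<in> K" for \<tau>
      using a(4)[folded \<tau>1_def \<tau>2_def, symmetric] that face_iff_subset[OF \<sigma>(1) that] v(1)
      by (auto simp: cofacets_def facet_of_def vertices_def)
    then have "apices K \<sigma> = {v. (v \<in> vertices \<tau>1 \<or> v \<in> vertices \<tau>2) \<and> v \<notin> \<sigma>}"
      using \<tau> unfolding apices_def by blast
    also have "\<dots> = {v. (v \<in> vertices \<tau>1 \<or> v \<in> vertices \<tau>2) \<and> v \<notin> S}"
      using vertex_mem_iff[OF \<sigma>(1)] \<tau> by (auto simp: S_def)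
    finally show ?thesis using V a by auto
  qed
  define R where "R r \<longleftrightarrow> (\<forall>v. v \<notin> S \<longrightarrow> r v = 0) \<and> (\<Sum>w\<in>S. r w) = 0
    \<and> (\<Sum>w\<in>S. r w *s red2 w) = red2 v1 + red2 v2" for r :: "real ^ 'm \<Rightarrow> bit"
  have R: "\<exists>!r. R r" unfolding R_def using apex_relation[OF um a(2) S(2)] .
  have "(\<forall>v. v \<notin> S \<longrightarrow> r v = 0) \<and> (\<Sum>v\<in>S. r v) = 0 \<and> (\<exists>w1 w2. w1 \<noteq> w2 \<and> {v1, v2} = {w1, w2}
      \<and> (\<Sum>v\<in>S. r v *s red2 v) = red2 w1 - red2 w2) \<longleftrightarrow> R r" for r
    unfolding R_def bit_vec_diff using a(1) by (auto simp: doubleton_eq_iff add.commute)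
  then have "rho_fun K \<sigma> = (THE r. R r)"
    unfolding rho_fun_def apices by (simp add: S_def)
  with theI'[OF R] have rho: "R (rho_fun K \<sigma>)" by simp
  have pair: "pairing2 (red2 v2 + red2 w) (jump \<sigma> (at_vertex x)) = rho_fun K \<sigma> x"
    if "x \<in> S" "w \<in> S" for x w
  proof -
    have g: "gradient2 (insert v1 S) (at_vertex x) (grad \<tau>1 (at_vertex x))"
      "gradient2 (insert v2 S) (at_vertex x) (grad \<tau>2 (at_vertex x))"
      using gradient2_iff_grad \<tau> V by metis+
    have "jump \<sigma> (at_vertex x) = grad \<tau>1 (at_vertex x) + grad \<tau>2 (at_vertex x)"
      using a(4) ne by (simp add: jump_def \<tau>1_def \<tau>2_def)
    then have "pairing2 (red2 v2 + red2 w) (jump \<sigma> (at_vertex x))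
      = (\<Sum>w\<in>S. rho_fun K \<sigma> w * at_vertex x w) + at_vertex x v1 + at_vertex x v2"
      using gradient_jump_eq_relation[OF g that(2) S(1)] rho unfolding R_def by simp
    also have "\<dots> = rho_fun K \<sigma> x"
      using that a(2,3) S(1) by (auto simp: at_vertex_def)
    finally show ?thesis .
  qed
  show ?thesis
  proof
    assume "jump \<sigma> (at_vertex v) = jump \<sigma> (at_vertex v')"
    then show "rho_fun K \<sigma> v = rho_fun K \<sigma> v'" using pair[of v v] pair[of v' v] v by (simp add: S_def)
  next
    assume eq: "rho_fun K \<sigma> v = rho_fun K \<sigma> v'"
    define k where "k = jump \<sigma> (at_vertex v) + jump \<sigma> (at_vertex v')"
    have gS: "gradient2 S (\<lambda>x. 0) (jump \<sigma> f)" for f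
    proof -
      have "gradient2 S (\<lambda>x. f x + f x) (grad \<tau>1 f + grad \<tau>2 f)"
        using gradient2_iff_grad[OF \<tau>(1,2)] gradient2_iff_grad[OF \<tau>(4,5)] V
        by (intro gradient2_add) (metis gradient2_subset subset_insertI)+
      then show ?thesis using a(4) ne by (simp add: jump_def \<tau>1_def \<tau>2_def)
    qed
    have kS: "gradient2 S (\<lambda>x. 0) k"
      using gradient2_add[OF gS[of "at_vertex v"] gS[of "at_vertex v'"]] by (simp add: k_def)
    have "pairing2 (red2 v2 + red2 v) k = 0"
      unfolding k_def pairing2_add_right using pair[of v v] pair[of v' v] v eq by (simp add: S_def)
    then have "gradient2 (insert v2 S) (\<lambda>x. 0) k" using gradient2_insert_0[OF kS] v by (simp add: S_def)
    then have "k = 0" using unimodular_kernel_trivial[OF um(2)] by blast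
    then show "jump \<sigma> (at_vertex v) = jump \<sigma> (at_vertex v')" using k_def bit_vec_eq_iff_add by metis
  qed
qed

section \<open>The Hessian of the indicator function of an interior vertex\<close>
lemma edge_cases:
  assumes "\<sigma> \<in> K" "s edge_of \<sigma>"
  obtains a b where "a \<in> vertices \<sigma>" "b \<in> vertices \<sigma>" "a \<noteq> b" "s = convex hull {a, b}"
    "vertices s = {a, b}"
proof -
  have s: "s \<in> K" "aff_dim s = 1" "s face_of \<sigma>" using assms face_in_K by (auto simp: edge_of_def)
  then have "card (vertices s) = 2" using K_simplex(4)[OF s(1)] by simp
  then obtain a b where ab: "vertices s = {a, b}" "a \<noteq> b" by (auto simp: card_2_iff)
  moreover have "{a, b} \<subseteq> vertices \<sigma>" using vertices_face_subset[OF s(3)] ab(1) by simp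
  moreover have "s = convex hull {a, b}"
    using K_simplex(3)[OF s(1)] ab(1) by simp
  ultimately show thesis using that[of a b] by auto
qed

lemma edge_hull:
  assumes "\<sigma> \<in> K" "a \<in> vertices \<sigma>" "b \<in> vertices \<sigma>" "a \<noteq> b"
  shows "convex hull {a, b} edge_of \<sigma>" "vertices (convex hull {a, b}) = {a, b}"
proof -
  have sub: "{a, b} \<subseteq> vertices \<sigma>" using assms by simp
  note h = hull_subset_vertices[OF assms(1) sub]
  show "vertices (convex hull {a, b}) = {a, b}" by (fact h(2))
  have "aff_dim (convex hull {a, b}) = 1" using K_simplex(4)[OF h(1)] h(2) assms(4) by simp
  moreover have "convex hull {a, b} face_of \<sigma>"
    using face_iff_subset[OF h(1) assms(1)] subset_iff_vertices[OF h(1) assms(1)] h(2) sub by simp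
  ultimately show "convex hull {a, b} edge_of \<sigma>" by (simp add: edge_of_def)
qed

text \<open>The bridge from the sheaf morphism \<open>z\<close> to gradients: a lift of the section \<open>d\<chi>\<^sub>v\<close> over a cell is a
  gradient of \<open>\<chi>\<^sub>v\<close> on the vertices of its simplex.\<close>
lemma z_map_eq_iff:
  assumes "\<sigma> \<in> K"
  shows "z_map (\<sigma>, Q) u = restrict_1cochain \<sigma> (simp_cobd (chi v)) \<longleftrightarrow> gradient2 (vertices \<sigma>) (at_vertex v) u"
proof
  assume eq: "z_map (\<sigma>, Q) u = restrict_1cochain \<sigma> (simp_cobd (chi v))"
  have "pairing2 (red2 a + red2 b) u = at_vertex v a + at_vertex v b"
    if ab: "a \<in> vertices \<sigma>" "b \<in> vertices \<sigma>" for a b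
  proof (cases "a = b")
    case False
    note e = edge_hull[OF assms ab False]
    have "z_map (\<sigma>, Q) u (convex hull {a, b}) = restrict_1cochain \<sigma> (simp_cobd (chi v)) (convex hull {a, b})"
      by (simp add: eq)
    then show ?thesis
      using e False by (simp add: z_map_def restrict_1cochain_def simp_cobd_chi_segment)
  qed simp
  then show "gradient2 (vertices \<sigma>) (at_vertex v) u" by (simp add: gradient2_def)
next
  assume g: "gradient2 (vertices \<sigma>) (at_vertex v) u"
  show "z_map (\<sigma>, Q) u = restrict_1cochain \<sigma> (simp_cobd (chi v))"
  proof
    fix s
    show "z_map (\<sigma>, Q) u s = restrict_1cochain \<sigma> (simp_cobd (chi v)) s"
    proof (cases "s edge_of \<sigma>")
      case True
      then obtain a b where ab: "a \<in> vertices \<sigma>" "b \<in> vertices \<sigma>" "a \<noteq> b" "s = convex hull {a, b}"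
        "vertices s = {a, b}"
        by (rule edge_cases[OF assms])
      then show ?thesis
        using True g simp_cobd_chi_segment[OF ab(3)] by (simp add: z_map_def restrict_1cochain_def gradient2_def)
    qed (simp add: z_map_def restrict_1cochain_def)
  qed
qed

lemma restrict_chi_away:
  assumes "\<sigma> \<in> K" "v \<notin> vertices \<sigma>"
  shows "restrict_1cochain \<sigma> (simp_cobd (chi v)) = 0"
proof -
  have "gradient2 (vertices \<sigma>) (at_vertex v) 0" using assms(2) by (auto simp: gradient2_def at_vertex_def)
  then have "z_map (\<sigma>, P) 0 = restrict_1cochain \<sigma> (simp_cobd (chi v))" using z_map_eq_iff[OF assms(1)] by blast
  then show ?thesis by simp
qed

text \<open>Each vertex of a triangle lies on two of its edges.\<close>
lemma restrict_chi_cocycle: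
  assumes "\<sigma> \<in> K"
  shows "restrict_1cochain \<sigma> (simp_cobd (chi v)) \<in> simp_Z1 \<sigma>"
proof -
  have "simp_cobd (restrict_1cochain \<sigma> (simp_cobd (chi v))) \<tau> = 0"
    if \<tau>: "\<tau> face_of \<sigma>" "aff_dim \<tau> = 2" for \<tau>
  proof -
    have \<tau>K: "\<tau> \<in> K" using face_in_K assms \<tau>(1) by blast
    have "card (vertices \<tau>) = 3" using K_simplex(4)[OF \<tau>K] \<tau>(2) by simp
    then obtain a b c where abc: "vertices \<tau> = {a, b, c}" "a \<noteq> b" "a \<noteq> c" "b \<noteq> c"
      by (auto simp: card_3_iff)
    have hull: "\<tau> = convex hull {a, b, c}" "\<not> affine_dependent {a, b, c}"
      using K_simplex(1,3)[OF \<tau>K] abc(1) by simp_all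
    have diff: "{a, b, c} - {a} = {b, c}" "{a, b, c} - {b} = {a, c}" "{a, b, c} - {c} = {a, b}"
      using abc by auto
    have "F facet_of \<tau> \<longleftrightarrow> F \<noteq> {} \<and> (F = convex hull ({a, b, c} - {a}) \<or> F = convex hull ({a, b, c} - {b})
        \<or> F = convex hull ({a, b, c} - {c}))" for F
      unfolding hull(1) facet_of_convex_hull_affine_independent[OF hull(2)] by blast
    then have facets: "{F. F facet_of \<tau>} = {convex hull {b, c}, convex hull {a, c}, convex hull {a, b}}"
      unfolding diff by auto
    have V: "a \<in> vertices \<tau>" "b \<in> vertices \<tau>" "c \<in> vertices \<tau>" using abc by auto
    note e = edge_hull[OF \<tau>K V(2,3) abc(4)] edge_hull[OF \<tau>K V(1,3) abc(3)] edge_hull[OF \<tau>K V(1,2) abc(2)]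
    have val: "restrict_1cochain \<sigma> (simp_cobd (chi v)) (convex hull {x, y}) = at_vertex v x + at_vertex v y"
      if "convex hull {x, y} edge_of \<tau>" "x \<noteq> y" for x y
    proof -
      have "convex hull {x, y} edge_of \<sigma>"
        using that(1) face_of_trans[OF _ \<tau>(1)] by (auto simp: edge_of_def)
      then show ?thesis using simp_cobd_chi_segment[OF that(2)] by (simp add: restrict_1cochain_def)
    qed
    have ne: "convex hull {b, c} \<noteq> convex hull {a, c}" "convex hull {b, c} \<noteq> convex hull {a, b}"
      "convex hull {a, c} \<noteq> convex hull {a, b}"
      using e(2,4,6) abc by (metis doubleton_eq_iff)+
    have "simp_cobd (restrict_1cochain \<sigma> (simp_cobd (chi v))) \<tau>
      = (at_vertex v b + at_vertex v c) + ((at_vertex v a + at_vertex v c) + (at_vertex v a + at_vertex v b))"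
      unfolding simp_cobd_def[of _ \<tau>] facets
      using ne val[OF e(1) abc(4)] val[OF e(3) abc(3)] val[OF e(5) abc(2)] by simp
    also have "\<dots> = 0"
      by (cases "at_vertex v a"; cases "at_vertex v b"; cases "at_vertex v c") simp_all
    finally show ?thesis .
  qed
  then show ?thesis by (auto simp: simp_Z1_def restrict_1cochain_def)
qed

definition chi_section :: "real ^ 'm \<Rightarrow> 'm cell \<Rightarrow> (real ^ 'm) set \<Rightarrow> bit"
  where "chi_section v = (\<lambda>e. if e \<in> cpx_X K P \<and> cell_dim e = 0
    then restrict_1cochain (fst e) (simp_cobd (chi v)) else 0)"

text \<open>At a 1-cell \<open>[\<sigma>, Q]\<close> with \<open>v\<close> outside \<open>\<sigma>\<close> all terms of the coboundary vanish; otherwise \<open>\<sigma>\<close> is an interior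
  facet and the two simplices that contain it contribute the same cochain \<open>d\<chi>\<^sub>v|\<^sub>\<sigma>\<close>.\<close>
lemma chi_section_cocycle:
  assumes v: "v \<in> interior_vertices K P"
  shows "chi_section v \<in> cocycles (cpx_X K P) sheaf_Z1 0"
proof -
  have zero: "restrict_1cochain \<sigma> 0 = 0" for \<sigma> :: "(real ^ 'm) set"
    by (simp add: restrict_1cochain_def fun_eq_iff)
  have "chi_section v \<in> cochains (cpx_X K P) sheaf_Z1 0"
    using restrict_chi_cocycle by (auto simp: cochains_def chi_section_def mem_X)
  moreover have "cobd (cpx_X K P) sheaf_Z1 (chi_section v) e = 0" for e
  proof (cases "e \<in> cpx_X K P")
    case True
    obtain \<sigma> Q where [simp]: "e = (\<sigma>, Q)" by fastforce
    have \<sigma>: "\<sigma> \<in> K" "1 \<le> aff_dim \<sigma>" "Q face_of P" "\<sigma> \<subseteq> Q" using True by (auto simp: mem_X)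
    have cobd: "cobd (cpx_X K P) sheaf_Z1 (chi_section v) e
        = (\<Sum>e'\<in>cell_facets (cpx_X K P) e. restrict_1cochain \<sigma> (chi_section v e'))"
      using True by (simp add: cobd_def cell_facets_def)
    have val: "restrict_1cochain \<sigma> (chi_section v e')
        = (if cell_dim e = 1 then restrict_1cochain \<sigma> (simp_cobd (chi v)) else 0)"
      if e': "e' \<in> cell_facets (cpx_X K P) e" for e'
    proof -
      have "\<sigma> face_of fst e'" using e' by (simp add: cell_facets_def cell_le_def)
      then show ?thesis
        using e' restrict_1cochain_face[of \<sigma> "fst e'"] by (auto simp: chi_section_def cell_facets_def zero)
    qed
    show ?thesis
    proof (cases "v \<in> vertices \<sigma> \<and> cell_dim e = 1")
      case False
      then show ?thesis unfolding cobd using val restrict_chi_away[OF \<sigma>(1)] by (auto intro!: sum.neutral)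
    next
      case 1: True
      then have v\<sigma>: "v \<in> \<sigma>" using vertices_subset by blast
      then have "Q = P" using face_through_interior_vertex[OF v _ \<sigma>(3)] \<sigma>(4) by blast
      have "aff_dim \<sigma> = int CARD('m) - 1" using 1 cell_dim_P[OF \<sigma>(1)] \<open>Q = P\<close> by simp
      then have "card (cofacets \<sigma>) = 2"
        using interior_facet[OF \<sigma>(1) _ not_frontier[OF v v\<sigma>]] by metis
      then have "card (cell_facets (cpx_X K P) e) = 2"
        using cell_facets_at_interior_vertex[OF v v\<sigma> \<sigma>(1,2)] \<open>Q = P\<close>
        by (simp add: card_image inj_on_def)
      then show ?thesis unfolding cobd
      proof (rule sum_const_two)
        show "restrict_1cochain \<sigma> (chi_section v x) = restrict_1cochain \<sigma> (simp_cobd (chi v))"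
          if "x \<in> cell_facets (cpx_X K P) e" for x using val[OF that] 1 by simp
      qed (simp add: fun_eq_iff)
    qed
  qed (simp add: cobd_def)
  ultimately show ?thesis by (auto simp: cocycles_def)
qed

lemma section_class_chi:
  assumes "v \<in> interior_vertices K P"
  shows "section_class (cpx_X K P) sheaf_Z1 (\<lambda>e. restrict_1cochain (fst e) (simp_cobd (chi v))) = {chi_section v}"
proof -
  have "coboundaries (cpx_X K P) sheaf_Z1 0 = {0}" by (simp add: coboundaries_def)
  from cohomologous_class_trivial[OF this] show ?thesis
    using chi_section_cocycle[OF assms] by (simp add: section_class_def chi_section_def)
qed

definition hessian_lifts :: "real ^ 'm \<Rightarrow> ('m cell \<Rightarrow> bit ^ 'm) set"
  where "hessian_lifts v = {g \<in> cochains (cpx_X K P) sheaf_N2 0. \<forall>\<sigma> Q.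
    (\<sigma>, Q) \<in> cpx_X K P \<longrightarrow> cell_dim (\<sigma>, Q) = 0 \<longrightarrow> gradient2 (vertices \<sigma>) (at_vertex v) (g (\<sigma>, Q))}"

lemma hessian_eq:
  assumes "v \<in> interior_vertices K P"
  shows "hessian K P (chi v) = cohomologous (cpx_X K P) sheaf_W1 1 ``
    (cobd (cpx_X K P) sheaf_N2 ` hessian_lifts v \<inter> cochains (cpx_X K P) sheaf_W1 1)"
proof -
  have "(\<lambda>e. z_map e (g e)) = chi_section v \<longleftrightarrow> g \<in> hessian_lifts v"
    if g: "g \<in> cochains (cpx_X K P) sheaf_N2 0" for g
  proof -
    have "z_map e (g e) = chi_section v e \<longleftrightarrow> (\<forall>\<sigma> Q. e = (\<sigma>, Q) \<longrightarrow>
        (\<sigma>, Q) \<in> cpx_X K P \<longrightarrow> cell_dim (\<sigma>, Q) = 0 \<longrightarrow> gradient2 (vertices \<sigma>) (at_vertex v) (g (\<sigma>, Q)))" for e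
    proof (cases "e \<in> cpx_X K P \<and> cell_dim e = 0")
      case True
      obtain \<sigma> Q where [simp]: "e = (\<sigma>, Q)" by fastforce
      have "\<sigma> \<in> K" using True by (simp add: mem_X)
      then show ?thesis using True z_map_eq_iff[of \<sigma> Q "g e" v] by (simp add: chi_section_def)
    next
      case False
      then have "g e = 0" using cochains_zero[OF g, of e] by auto
      then show ?thesis using False by (auto simp: chi_section_def)
    qed
    then show ?thesis using g by (auto simp: hessian_lifts_def fun_eq_iff)
  qed
  then have "{c \<in> cochains (cpx_X K P) sheaf_W1 1. \<exists>g\<in>cochains (cpx_X K P) sheaf_N2 0.
      (\<lambda>e. z_map e (g e)) \<in> {chi_section v} \<and> (\<lambda>e. c e) = cobd (cpx_X K P) sheaf_N2 g}
    = cobd (cpx_X K P) sheaf_N2 ` hessian_lifts v \<inter> cochains (cpx_X K P) sheaf_W1 1"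
    by (auto simp: hessian_lifts_def)
  then show ?thesis
    unfolding hessian_def connecting_def section_class_chi[OF assms] by simp
qed

definition local_hessian :: "real ^ 'm \<Rightarrow> 'm cell \<Rightarrow> bit ^ 'm"
  where "local_hessian v = (\<lambda>e. if e \<in> dual_cell_boundary K P {v} \<and> cell_dim e = 1
    then jump (fst e) (at_vertex v) else 0)"

text \<open>The choices in the definition of the Hessian have no effect on \<open>\<partial>v\<^sup>*\<close>: the 0-cells there belong to
  full-dimensional simplices, on which lifts are unique and 0-cochains of \<open>\<W>\<^sub>1\<close> vanish.\<close>
lemma hessian_representative_restrict:
  assumes v: "v \<in> interior_vertices K P"
    and c': "c' \<in> hessian K P (chi v)"
  shows "restrict_cochain (dual_cell_boundary K P {v}) c' = local_hessian v"
proof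
  fix e
  let ?X = "cpx_X K P"
  obtain g c where g: "g \<in> hessian_lifts v" "c = cobd ?X sheaf_N2 g" "(c, c') \<in> cohomologous ?X sheaf_W1 1"
    using c' unfolding hessian_eq[OF v] by blast
  then have c'c: "c' \<in> cochains ?X sheaf_W1 1" and "c - c' \<in> cobd ?X sheaf_W1 ` cochains ?X sheaf_W1 0"
    by (auto simp: cohomologous_def cocycles_def coboundaries_def)
  then obtain b where b: "b \<in> cochains ?X sheaf_W1 0" "c - c' = cobd ?X sheaf_W1 b" by blast
  show "restrict_cochain (dual_cell_boundary K P {v}) c' e = local_hessian v e"
  proof (cases "e \<in> dual_cell_boundary K P {v} \<and> cell_dim e = 1")
    case False
    then show ?thesis using cochains_zero[OF c'c, of e] by (auto simp: restrict_cochain_def local_hessian_def)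
  next
    case True
    then obtain \<sigma> where \<sigma>: "\<sigma> \<in> K" "e = (\<sigma>, P)" "v \<in> \<sigma>" "1 \<le> aff_dim \<sigma>"
      using mem_dual_boundary[OF v] by blast
    have eX: "e \<in> ?X" using True dual_boundary_subset_X0[OF v] X0_subset_X by blast
    have dim\<sigma>: "aff_dim \<sigma> = int CARD('m) - 1" using True cell_dim_P[OF \<sigma>(1)] \<sigma>(2) by simp
    have top: "\<tau> \<in> K" "aff_dim \<tau> = int CARD('m)" "(\<tau>, P) \<in> ?X" "cell_dim (\<tau>, P) = 0"
      if \<tau>: "\<tau> \<in> cofacets \<sigma>" for \<tau>
      using \<tau> dim\<sigma> dim_ge_2 subset_P face_of_refl[OF convex_P] cell_dim_P by (auto simp: cofacets_def mem_X)
    have "b (\<tau>, P) = 0" if \<tau>: "\<tau> \<in> cofacets \<sigma>" for \<tau>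
    proof -
      have "b (\<tau>, P) \<in> stalk sheaf_W1 (\<tau>, P)"
        using cochains_stalk[OF b(1) top(3)[OF \<tau>]] top(4)[OF \<tau>] by simp
      then show ?thesis using stalk_W1_top[OF top(1,2)[OF \<tau>]] by simp
    qed
    then have "cobd ?X sheaf_W1 b e = 0"
      using cobd_W1[OF eX, of b] sum_cell_facets[OF v \<sigma>(3,1,4), of b] \<sigma>(2) by simp
    moreover have "c e - c' e = cobd ?X sheaf_W1 b e" using b(2) by (metis fun_diff_def)
    ultimately have "c' e = c e" by simp
    also have "c e = (\<Sum>\<tau>\<in>cofacets \<sigma>. g (\<tau>, P))"
      using cobd_N2[OF eX] sum_cell_facets[OF v \<sigma>(3,1,4)] \<sigma>(2) g(2) by simp
    also have "\<dots> = jump \<sigma> (at_vertex v)"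
      unfolding jump_def
    proof (rule sum.cong[OF refl])
      fix \<tau> assume \<tau>: "\<tau> \<in> cofacets \<sigma>"
      have "gradient2 (vertices \<tau>) (at_vertex v) (g (\<tau>, P))"
        using g(1) top(3,4)[OF \<tau>] by (simp add: hessian_lifts_def)
      then show "g (\<tau>, P) = grad \<tau> (at_vertex v)" using gradient2_iff_grad[OF top(1,2)[OF \<tau>]] by blast
    qed
    finally show ?thesis using True \<sigma>(2) by (simp add: restrict_cochain_def local_hessian_def)
  qed
qed

text \<open>The lift of \<open>d\<chi>\<^sub>v\<close> that is zero over all 0-cells of \<open>X\<close> in the boundary of \<open>P\<close>.  It exists because \<open>\<chi>\<^sub>v\<close>
  vanishes on the boundary.  With this choice only pairs of a simplex and \<open>P\<close> matter in the following
  calculations on the whole of \<open>X\<close>.\<close>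
definition star_lift :: "real ^ 'm \<Rightarrow> 'm cell \<Rightarrow> bit ^ 'm"
  where "star_lift v = (\<lambda>e. if e \<in> cpx_X K P \<and> cell_dim e = 0 \<and> snd e = P
    then grad (fst e) (at_vertex v) else 0)"

lemma star_lift_gradient:
  assumes v: "v \<in> interior_vertices K P" and e: "(\<tau>, Q) \<in> cpx_X K P" "cell_dim (\<tau>, Q) = 0"
  shows "gradient2 (vertices \<tau>) (at_vertex v) (star_lift v (\<tau>, Q))"
proof (cases "Q = P")
  case True
  have "\<tau> \<in> K" using e(1) by (simp add: mem_X)
  moreover from this have "aff_dim \<tau> = int CARD('m)" using e(2) True cell_dim_P by simp
  ultimately show ?thesis using gradient2_iff_grad e True by (simp add: star_lift_def)
next
  case False
  have "Q face_of P" "\<tau> \<subseteq> Q" using e(1) by (auto simp: mem_X)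
  then have "v \<notin> \<tau>" using face_through_interior_vertex[OF v, of Q] False by blast
  then have "v \<notin> vertices \<tau>" using vertices_subset by blast
  then show ?thesis using False by (auto simp: star_lift_def gradient2_def at_vertex_def)
qed

text \<open>At a 1-cell \<open>[\<sigma>, Q]\<close> every term of the coboundary is a gradient of \<open>\<chi>\<^sub>v\<close> on \<open>\<sigma>\<close>.  If \<open>v\<close> is not a vertex of
  \<open>\<sigma>\<close>, each of them kills \<open>\<sigma>\<close>; otherwise there are two of them, and their sum kills \<open>\<sigma>\<close>.\<close>
lemma cobd_star_lift_cochain:
  assumes v: "v \<in> interior_vertices K P"
  shows "cobd (cpx_X K P) sheaf_N2 (star_lift v) \<in> cochains (cpx_X K P) sheaf_W1 1"
proof -
  let ?X = "cpx_X K P"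
  have "cobd ?X sheaf_N2 (star_lift v) e \<in> stalk sheaf_W1 e"
    if e: "e \<in> ?X" "cell_dim e = 1" for e
  proof -
    obtain \<sigma> Q where [simp]: "e = (\<sigma>, Q)" by fastforce
    have \<sigma>: "\<sigma> \<in> K" "1 \<le> aff_dim \<sigma>" "Q face_of P" "\<sigma> \<subseteq> Q" using e(1) by (auto simp: mem_X)
    have lift: "gradient2 (vertices \<sigma>) (at_vertex v) (star_lift v e')" if e': "e' \<in> cell_facets ?X e" for e'
    proof -
      obtain \<tau> R where [simp]: "e' = (\<tau>, R)" by fastforce
      have "(\<tau>, R) \<in> ?X" "cell_dim (\<tau>, R) = 0" "\<sigma> face_of \<tau>"
        using e' e(2) by (auto simp: cell_facets_def cell_le_def)
      then show ?thesis
        using gradient2_subset[OF star_lift_gradient[OF v] vertices_face_subset] by simp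
    qed
    have "gradient2 (vertices \<sigma>) (\<lambda>x. 0) (sum (star_lift v) (cell_facets ?X e))"
    proof (cases "v \<in> vertices \<sigma>")
      case False
      have "gradient2 (vertices \<sigma>) (\<lambda>x. 0) (star_lift v e')" if e': "e' \<in> cell_facets ?X e" for e'
        using lift[OF e'] False by (auto simp: gradient2_def at_vertex_def)
      then show ?thesis by (rule gradient2_sum)
    next
      case True
      then have v\<sigma>: "v \<in> \<sigma>" using vertices_subset by blast
      then have QP: "Q = P" using face_through_interior_vertex[OF v _ \<sigma>(3)] \<sigma>(4) by blast
      have "aff_dim \<sigma> = int CARD('m) - 1" using e(2) cell_dim_P[OF \<sigma>(1)] QP by simp
      then have "card (cofacets \<sigma>) = 2"
        using interior_facet[OF \<sigma>(1) _ not_frontier[OF v v\<sigma>]] by metis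
      then have "card (cell_facets ?X e) = 2"
        using cell_facets_at_interior_vertex[OF v v\<sigma> \<sigma>(1,2)] QP by (simp add: card_image inj_on_def)
      then obtain e1 e2 where e12: "cell_facets ?X e = {e1, e2}" "e1 \<noteq> e2" by (auto simp: card_2_iff)
      then show ?thesis using gradient2_add[OF lift[of e1] lift[of e2]] by simp
    qed
    moreover have "\<sigma> \<noteq> {}" using \<sigma>(2) by auto
    ultimately show ?thesis using stalk_W1[OF \<sigma>(1)] cobd_N2[OF e(1)] by simp
  qed
  moreover have "cobd ?X sheaf_N2 (star_lift v) e = 0" if e: "\<not> (e \<in> ?X \<and> cell_dim e = 1)" for e
  proof (cases "e \<in> ?X")
    case True
    then have "star_lift v e' = 0" if "e' \<in> cell_facets ?X e" for e'
      using that e by (auto simp: cell_facets_def star_lift_def)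
    then show ?thesis using cobd_N2[OF True] by simp
  qed (simp add: cobd_def)
  ultimately show ?thesis by (auto simp: cochains_def)
qed

text \<open>The value of the lift at \<open>[\<tau>, P]\<close> reaches a cell \<open>[\<sigma>, P]\<close> of dimension 2 along the two simplices
  between \<open>\<sigma>\<close> and \<open>\<tau>\<close>, and so contributes twice.\<close>
lemma cobd_star_lift_closed:
  assumes v: "v \<in> interior_vertices K P"
  shows "cobd (cpx_X K P) sheaf_W1 (cobd (cpx_X K P) sheaf_N2 (star_lift v)) = 0"
proof
  fix e
  let ?X = "cpx_X K P"
  let ?between = "\<lambda>e''. {e' \<in> cell_facets ?X e. e'' \<in> cell_facets ?X e'}"
  show "cobd ?X sheaf_W1 (cobd ?X sheaf_N2 (star_lift v)) e = 0 e"
  proof (cases "e \<in> ?X")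
    case True
    obtain \<sigma> Q where [simp]: "e = (\<sigma>, Q)" by fastforce
    have \<sigma>: "\<sigma> \<in> K" "1 \<le> aff_dim \<sigma>" "Q face_of P" "\<sigma> \<subseteq> Q" using True by (auto simp: mem_X)
    have fin: "finite (cell_facets ?X e)" using finite_X by (simp add: cell_facets_def)
    have "cobd ?X sheaf_W1 (cobd ?X sheaf_N2 (star_lift v)) e
        = (\<Sum>e'\<in>cell_facets ?X e. sum (star_lift v) (cell_facets ?X e'))"
      unfolding cobd_W1[OF True] by (intro sum.cong refl cobd_N2) (simp add: cell_facets_def)
    also have "\<dots> = (\<Sum>e'\<in>cell_facets ?X e. sum (star_lift v) {e''. e'' \<in> ?X \<and> e'' \<in> cell_facets ?X e'})"
      by (intro sum.cong refl arg_cong[where f = "sum (star_lift v)"]) (auto simp: cell_facets_def)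
    also have "\<dots> = (\<Sum>e''\<in>?X. \<Sum>e'\<in>?between e''. star_lift v e'')"
      by (rule sum.swap_restrict[OF fin finite_X])
    also have "\<dots> = 0"
    proof (rule sum.neutral, rule ballI)
      fix e'' assume e'': "e'' \<in> ?X"
      show "(\<Sum>e'\<in>?between e''. star_lift v e'') = 0"
      proof (cases "?between e'' = {} \<or> star_lift v e'' = 0")
        case False
        then have nz: "star_lift v e'' \<noteq> 0" and ne: "?between e'' \<noteq> {}" by blast+
        define \<tau> where "\<tau> = fst e''"
        have \<tau>P: "e'' = (\<tau>, P)" "cell_dim (\<tau>, P) = 0"
          using nz by (auto simp: star_lift_def \<tau>_def prod_eq_iff split: if_splits)
        have \<tau>K: "\<tau> \<in> K" using e'' \<tau>P by (simp add: mem_X)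
        obtain e' where "e' \<in> ?between e''" using ne by blast
        then have e': "\<sigma> face_of fst e'" "snd e' \<subseteq> Q" "fst e' face_of \<tau>" "P \<subseteq> snd e'" "cell_dim e = 2"
          using \<tau>P by (auto simp: cell_facets_def cell_le_def)
        then have QP: "Q = P" using face_of_imp_subset[OF \<sigma>(3)] by blast
        have "\<sigma> \<subseteq> \<tau>" using face_of_imp_subset[OF e'(1)] face_of_imp_subset[OF e'(3)] by blast
        have dim: "aff_dim \<tau> = aff_dim \<sigma> + 2"
          using e'(5) \<tau>P(2) cell_dim_P[OF \<sigma>(1)] cell_dim_P[OF \<tau>K] QP by simp
        have "?between e'' = (\<lambda>\<upsilon>. (\<upsilon>, P)) ` {\<upsilon>\<in>K. \<sigma> \<subseteq> \<upsilon> \<and> \<upsilon> \<subseteq> \<tau> \<and> aff_dim \<upsilon> = aff_dim \<sigma> + 1}"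
        proof (intro equalityI subsetI)
          fix x assume x: "x \<in> ?between e''"
          obtain \<upsilon> R where [simp]: "x = (\<upsilon>, R)" by fastforce
          have *: "\<upsilon> \<in> K" "R face_of P" "\<sigma> face_of \<upsilon>" "\<upsilon> face_of \<tau>" "P \<subseteq> R" "cell_dim e = cell_dim x + 1"
            using x \<tau>P by (auto simp: cell_facets_def cell_le_def mem_X)
          have "R = P" using *(2,5) face_of_imp_subset by blast
          moreover have "aff_dim \<upsilon> = aff_dim \<sigma> + 1"
            using *(6) cell_dim_P[OF \<sigma>(1)] cell_dim_P[OF *(1)] QP \<open>R = P\<close> by simp
          ultimately show "x \<in> (\<lambda>\<upsilon>. (\<upsilon>, P)) ` {\<upsilon>\<in>K. \<sigma> \<subseteq> \<upsilon> \<and> \<upsilon> \<subseteq> \<tau> \<and> aff_dim \<upsilon> = aff_dim \<sigma> + 1}"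
            using *(1) face_of_imp_subset[OF *(3)] face_of_imp_subset[OF *(4)] by simp
        next
          fix x assume "x \<in> (\<lambda>\<upsilon>. (\<upsilon>, P)) ` {\<upsilon>\<in>K. \<sigma> \<subseteq> \<upsilon> \<and> \<upsilon> \<subseteq> \<tau> \<and> aff_dim \<upsilon> = aff_dim \<sigma> + 1}"
          then obtain \<upsilon> where \<upsilon>: "x = (\<upsilon>, P)" "\<upsilon> \<in> K" "\<sigma> \<subseteq> \<upsilon>" "\<upsilon> \<subseteq> \<tau>" "aff_dim \<upsilon> = aff_dim \<sigma> + 1" by blast
          then show "x \<in> ?between e''"
            using face_iff_subset[OF \<sigma>(1) \<upsilon>(2)] face_iff_subset[OF \<upsilon>(2) \<tau>K] subset_P[OF \<upsilon>(2)] \<sigma>(2)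
              face_of_refl[OF convex_P] cell_dim_P[OF \<upsilon>(2)] cell_dim_P[OF \<sigma>(1)] cell_dim_P[OF \<tau>K] dim e'' \<tau>P QP
            by (simp add: cell_facets_def cell_le_def mem_X)
        qed
        then have "card (?between e'') = 2"
          using two_intermediate_simplices[OF \<sigma>(1) \<tau>K \<open>\<sigma> \<subseteq> \<tau>\<close> dim] by (simp add: card_image inj_on_def)
        then show ?thesis by (rule sum_const_two) auto
      next
        case True
        then show ?thesis by (elim disjE) (simp_all only: sum.empty sum.neutral_const)
      qed
    qed
    finally show ?thesis by simp
  qed (simp add: cobd_def)
qed

text \<open>The Hessian is a nonempty set, so that its restriction is a class and not the empty set.\<close>
lemma cobd_star_lift_in_hessian:
  assumes v: "v \<in> interior_vertices K P"
  shows "cobd (cpx_X K P) sheaf_N2 (star_lift v) \<in> hessian K P (chi v)"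
proof -
  let ?X = "cpx_X K P" and ?c = "cobd (cpx_X K P) sheaf_N2 (star_lift v)"
  have "star_lift v \<in> cochains ?X sheaf_N2 0" by (auto simp: cochains_def star_lift_def)
  then have "star_lift v \<in> hessian_lifts v"
    using star_lift_gradient[OF v] by (simp add: hessian_lifts_def)
  moreover have cocyc: "?c \<in> cocycles ?X sheaf_W1 1"
    using cobd_star_lift_cochain[OF v] cobd_star_lift_closed[OF v] by (simp add: cocycles_def)
  moreover have "(?c, ?c) \<in> cohomologous ?X sheaf_W1 1"
  proof -
    have "0 \<in> cochains ?X sheaf_W1 0" by (simp add: cochains_def zero_in_stalk_W1)
    moreover have "cobd ?X sheaf_W1 0 = 0" by (simp add: cobd_def fun_eq_iff)
    ultimately have "0 \<in> coboundaries ?X sheaf_W1 1" by (auto simp: coboundaries_def image_iff intro!: bexI[of _ 0])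
    then show ?thesis using cocyc by (simp add: cohomologous_def)
  qed
  ultimately show ?thesis unfolding hessian_eq[OF v] using cobd_star_lift_cochain[OF v] by blast
qed

lemma local_hessian_cocycle:
  assumes v: "v \<in> interior_vertices K P"
  shows "local_hessian v \<in> cocycles (dual_cell_boundary K P {v}) sheaf_W1 1"
proof -
  have "cobd (cpx_X K P) sheaf_N2 (star_lift v) \<in> cocycles (cpx_X K P) sheaf_W1 1"
    using cobd_star_lift_cochain[OF v] cobd_star_lift_closed[OF v] by (simp add: cocycles_def)
  then have "restrict_cochain (dual_cell_boundary K P {v}) (cobd (cpx_X K P) sheaf_N2 (star_lift v))
      \<in> cocycles (dual_cell_boundary K P {v}) sheaf_W1 1"
    using dual_boundary_subset_X0[OF v] X0_subset_X dual_boundary_closed[OF v]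
    by (intro restrict_cochain_cocycle) auto
  then show ?thesis using hessian_representative_restrict[OF v cobd_star_lift_in_hessian[OF v]] by simp
qed

lemma restrict_class_hessian:
  assumes v: "v \<in> interior_vertices K P"
  shows "restrict_class (dual_cell_boundary K P {v}) sheaf_W1 1 (hessian K P (chi v)) = {local_hessian v}"
proof -
  have "restrict_cochain (dual_cell_boundary K P {v}) ` hessian K P (chi v) = {local_hessian v}"
    using hessian_representative_restrict[OF v] cobd_star_lift_in_hessian[OF v] by (auto simp: image_iff)
  then show ?thesis
    using local_hessian_cocycle[OF v]
      cohomologous_class_trivial[OF coboundaries_1_W1[OF dual_boundary_subset_X0[OF v]]]
    by (simp add: restrict_class_def restrict_cochain_def)
qed

section \<open>Uniformity and the functions \<open>\<rho>\<^sub>\<sigma>\<close>\<close>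
lemma rho_uniform_iff_cocycle:
  "rho_uniform K P \<longleftrightarrow> (\<exists>c\<in>cocycles (cpx_X0 K P) sheaf_W1 1. \<forall>v\<in>interior_vertices K P.
    restrict_cochain (dual_cell_boundary K P {v}) c = local_hessian v)"
proof -
  have coh: "cohomology (cpx_X0 K P) sheaf_W1 1 = (\<lambda>c. {c}) ` cocycles (cpx_X0 K P) sheaf_W1 1"
    unfolding cohomology_def quotient_def cohomologous_class_trivial[OF coboundaries_1_W1[OF order_refl]]
    by auto
  have "restrict_class (dual_cell_boundary K P {v}) sheaf_W1 1 {c} = {restrict_cochain (dual_cell_boundary K P {v}) c}"
    if v: "v \<in> interior_vertices K P" and c: "c \<in> cocycles (cpx_X0 K P) sheaf_W1 1" for v c
  proof -
    have "restrict_cochain (dual_cell_boundary K P {v}) c \<in> cocycles (dual_cell_boundary K P {v}) sheaf_W1 1"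
      using dual_boundary_closed[OF v] X0_subset_X
      by (intro restrict_cochain_cocycle[OF dual_boundary_subset_X0[OF v] _ c]) blast
    then show ?thesis
      using cohomologous_class_trivial[OF coboundaries_1_W1[OF dual_boundary_subset_X0[OF v]]]
      by (simp add: restrict_class_def restrict_cochain_def)
  qed
  then show ?thesis
    unfolding rho_uniform_def coh using restrict_class_hessian by auto
qed

theorem rho_uniform_iff_rho_constant:
  "rho_uniform K P \<longleftrightarrow> (\<forall>\<sigma>\<in>interior_simplices K P (int CARD('m) - 1).
    rho_fun K \<sigma> constant_on (vertices \<sigma> \<inter> interior_vertices K P))"
proof
  assume "rho_uniform K P"
  then obtain c where c: "\<And>v. v \<in> interior_vertices K P \<Longrightarrow>
      restrict_cochain (dual_cell_boundary K P {v}) c = local_hessian v"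
    unfolding rho_uniform_iff_cocycle by blast
  show "\<forall>\<sigma>\<in>interior_simplices K P (int CARD('m) - 1).
    rho_fun K \<sigma> constant_on (vertices \<sigma> \<inter> interior_vertices K P)"
  proof
    fix \<sigma> assume "\<sigma> \<in> interior_simplices K P (int CARD('m) - 1)"
    then have \<sigma>: "\<sigma> \<in> K" "aff_dim \<sigma> = int CARD('m) - 1" "\<not> \<sigma> \<subseteq> frontier P"
      by (auto simp: interior_simplices_def)
    have "c (\<sigma>, P) = jump \<sigma> (at_vertex v)" if v: "v \<in> vertices \<sigma> \<inter> interior_vertices K P" for v
    proof -
      have "(\<sigma>, P) \<in> dual_cell_boundary K P {v}"
        using v \<sigma> dim_ge_2 vertices_subset mem_dual_boundary[of v] by auto
      moreover have "cell_dim (\<sigma>, P) = 1" using cell_dim_P[OF \<sigma>(1)] \<sigma>(2) by simp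
      ultimately show ?thesis
        using fun_cong[OF c[of v], of "(\<sigma>, P)"] v by (simp add: restrict_cochain_def local_hessian_def)
    qed
    then have "rho_fun K \<sigma> v = rho_fun K \<sigma> v'"
      if "v \<in> vertices \<sigma> \<inter> interior_vertices K P" "v' \<in> vertices \<sigma> \<inter> interior_vertices K P" for v v'
      using jump_eq_iff_rho[OF \<sigma>, of v v'] that by (metis IntD1)
    then show "rho_fun K \<sigma> constant_on (vertices \<sigma> \<inter> interior_vertices K P)"
      unfolding constant_on_def by metis
  qed
next
  assume const: "\<forall>\<sigma>\<in>interior_simplices K P (int CARD('m) - 1).
    rho_fun K \<sigma> constant_on (vertices \<sigma> \<inter> interior_vertices K P)"
  let ?X0 = "cpx_X0 K P"
  \<comment> \<open>The choice of an interior vertex of \<open>\<sigma>\<close> is immaterial by the hypothesis.\<close>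
  define pick where "pick \<sigma> = (SOME v. v \<in> interior_vertices K P \<and> v \<in> \<sigma>)" for \<sigma>
  define c where "c = (\<lambda>e. if e \<in> ?X0 \<and> cell_dim e = 1 then jump (fst e) (at_vertex (pick (fst e))) else 0)"
  have restrict: "restrict_cochain (dual_cell_boundary K P {v}) c = local_hessian v"
    if v: "v \<in> interior_vertices K P" for v
  proof
    fix e
    show "restrict_cochain (dual_cell_boundary K P {v}) c e = local_hessian v e"
    proof (cases "e \<in> dual_cell_boundary K P {v} \<and> cell_dim e = 1")
      case True
      then obtain \<sigma> where \<sigma>: "\<sigma> \<in> K" "e = (\<sigma>, P)" "v \<in> \<sigma>" using mem_dual_boundary[OF v] by blast
      have dim\<sigma>: "aff_dim \<sigma> = int CARD('m) - 1" using True cell_dim_P[OF \<sigma>(1)] \<sigma>(2) by simp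
      have nf: "\<not> \<sigma> \<subseteq> frontier P" using not_frontier[OF v \<sigma>(3)] .
      have p: "pick \<sigma> \<in> interior_vertices K P" "pick \<sigma> \<in> \<sigma>"
        using someI[of "\<lambda>v. v \<in> interior_vertices K P \<and> v \<in> \<sigma>" v] v \<sigma>(3) by (simp_all add: pick_def)
      have vert: "v \<in> vertices \<sigma>" "pick \<sigma> \<in> vertices \<sigma>"
        using mem_vertices_iff[OF interior_vertexD(1) \<sigma>(1)] v \<sigma>(3) p by blast+
      have "\<sigma> \<in> interior_simplices K P (int CARD('m) - 1)"
        using \<sigma>(1) dim\<sigma> nf by (simp add: interior_simplices_def)
      then have "rho_fun K \<sigma> (pick \<sigma>) = rho_fun K \<sigma> v"
        using const vert v p(1) unfolding constant_on_def by (metis IntI)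
      then have "jump \<sigma> (at_vertex (pick \<sigma>)) = jump \<sigma> (at_vertex v)"
        using jump_eq_iff_rho[OF \<sigma>(1) dim\<sigma> nf vert(2,1)] by blast
      then show ?thesis
        using True \<sigma>(2) dual_boundary_subset_X0[OF v] by (auto simp: restrict_cochain_def local_hessian_def c_def)
    qed (auto simp: restrict_cochain_def local_hessian_def c_def)
  qed
  have "c e \<in> stalk sheaf_W1 e" if e: "e \<in> ?X0" "cell_dim e = 1" for e
  proof -
    obtain v where v: "v \<in> interior_vertices K P" "e \<in> dual_cell_boundary K P {v}" using e(1) mem_X0 by blast
    have "local_hessian v \<in> cochains (dual_cell_boundary K P {v}) sheaf_W1 1"
      using local_hessian_cocycle[OF v(1)] by (simp add: cocycles_def)
    then have "local_hessian v e \<in> stalk sheaf_W1 e" using cochains_stalk v(2) e(2) by (metis of_nat_1)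
    then show ?thesis using fun_cong[OF restrict[OF v(1)], of e] v(2) by (simp add: restrict_cochain_def)
  qed
  then have "c \<in> cochains ?X0 sheaf_W1 1" by (auto simp: cochains_def c_def)
  moreover have "cobd ?X0 sheaf_W1 c e = 0" for e
  proof (cases "e \<in> ?X0")
    case True
    then obtain v where v: "v \<in> interior_vertices K P" "e \<in> dual_cell_boundary K P {v}" using mem_X0 by blast
    have "cobd (dual_cell_boundary K P {v}) sheaf_W1 (local_hessian v)
        = restrict_cochain (dual_cell_boundary K P {v}) (cobd ?X0 sheaf_W1 c)"
      unfolding restrict[OF v(1), symmetric]
      using dual_boundary_closed[OF v(1)] X0_subset_X
      by (intro cobd_restrict_cochain[OF dual_boundary_subset_X0[OF v(1)]]) blast
    moreover have "cobd (dual_cell_boundary K P {v}) sheaf_W1 (local_hessian v) = 0"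
      using local_hessian_cocycle[OF v(1)] by (simp add: cocycles_def)
    ultimately have "restrict_cochain (dual_cell_boundary K P {v}) (cobd ?X0 sheaf_W1 c) e = 0" by simp
    then show ?thesis using v(2) by (simp add: restrict_cochain_def)
  qed (simp add: cobd_def)
  ultimately have "c \<in> cocycles ?X0 sheaf_W1 1" by (auto simp: cocycles_def)
  then show "rho_uniform K P" unfolding rho_uniform_iff_cocycle using restrict by blast
qed

end

theorem proposition3p34:
  fixes P :: "(real ^ 'm) set" and K :: "(real ^ 'm) set set" and n :: nat
  assumes "CARD('m) = n + 1" and "n \<ge> 1"
    and "smooth_polytope P"
    and "primitive_triangulation K P"
  shows "rho_uniform K P \<longleftrightarrow>
    (\<forall>\<sigma>\<in>interior_simplices K P (int n).
        rho_fun K \<sigma> constant_on (vertices \<sigma> \<inter> interior_vertices K P))"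
proof -
  have "polytope P" using assms(3) by (simp add: smooth_polytope_def simple_polytope_def)
  then interpret unimodular_complex K P
    using primitive_triangulation_unimodular_complex[OF assms(4)] assms(1,2) by simp
  have "int CARD('m) - 1 = int n" using assms(1) by simp
  then show ?thesis using rho_uniform_iff_rho_constant by simp
qed

end
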